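(* Let $\mathcal{H}$ be a Hopf algebra over a field $C$, let $M$ be a finite-dimensional left $\mathcal{H}$-module with associated matrix representation $\pi$, and let $\mathcal{H}^\circ_\pi$ be the co-representation Hopf algebra of $\pi$, regarded as a left $\mathcal{H}$-module algebra. Then: (II) The $\mathcal{H}$-module $M$ is trivialized by $\mathcal{H}^\circ_\pi$. (III) The $\mathcal{H}$-module algebra $\mathcal{H}^\circ_\pi$ is simple in the sense that it includes no non-trivial $\mathcal{H}$-stable ideals. Moreover, it includes no non-trivial $\mathcal{H}$-stable right ideals.
   Context: $\mathcal{H}^\circ$ is the dual Hopf algebra of $\mathcal{H}$ (the union of $(\mathcal{H}/I)^*$ over co-finite ideals $I$). For a matrix representation $\pi:\mathcal{H}\to M_n(C)$, $\mathrm{cf}(\pi)=\mathrm{Im}(\pi^*:M_n(C)^*\to\mathcal{H}^* )\subset\mathcal{H}^\circ$ is the coefficient co-algebra, and $\mathcal{H}^\circ_\pi$ is the smallest Hopf sub-algebra of $\mathcal{H}^\circ$ including $\mathrm{cf}(\pi)$. It is a left $\mathcal{H}$-module algebra by $hx=\sum x_{(1)}\langle x_{(2)},h\rangle$. A left $\mathcal{H}$-module $M$ is trivialized by a left $\mathcal{H}$-module algebra $\mathcal{R}$ if the $\mathcal{H}$-module $M\otimes\mathcal{R}$ (tensor product over $C$, diagonal action) is isomorphic to a direct sum of copies of $\mathcal{R}$. "Non-trivial" means different from $0$ and the whole algebra. *)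

theory Defs
  imports "HOL-Library.Function_Algebras" "Jordan_Normal_Form.Matrix"
begin

section \<open>Tensor products of vector spaces over a field\<close>

text \<open>Vector spaces are given by a scalar multiplication on a type of class
  \<open>ab_group_add\<close> (locale \<open>vector_space\<close>) and a subspace of it. Functions are
  added pointwise (\<open>Function_Algebras\<close>) and scaled pointwise by \<open>fscale\<close>.\<close>

definition fscale :: "'k::field \<Rightarrow> ('a \<Rightarrow> 'k) \<Rightarrow> 'a \<Rightarrow> 'k" where
  "fscale c f = (\<lambda>x. c * f x)"

definition bilinear_form ::
  "('k::field \<Rightarrow> 'v::ab_group_add \<Rightarrow> 'v) \<Rightarrow> ('k \<Rightarrow> 'w::ab_group_add \<Rightarrow> 'w) \<Rightarrow> ('v \<Rightarrow> 'w \<Rightarrow> 'k) \<Rightarrow> bool" where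
  "bilinear_form sV sW \<beta> \<longleftrightarrow>
     (\<forall>v. Vector_Spaces.linear sW (*) (\<beta> v)) \<and> (\<forall>w. Vector_Spaces.linear sV (*) (\<lambda>v. \<beta> v w))"

text \<open>Over a field, \<open>V \<otimes> W\<close> embeds into the dual of its own dual, and that
  dual is the space of bilinear forms on \<open>V \<times> W\<close>. Hence \<open>V \<otimes> W\<close> is realised as the
  span of the evaluations \<open>v \<otimes> w = (\<beta> \<mapsto> \<beta>(v, w))\<close>; \<open>tensor_lift_unique\<close> below is its
  universal property. If \<open>V\<close> and \<open>W\<close> are subspaces of larger spaces, \<open>V \<otimes> W\<close> is formed
  inside the tensor product of those, into which it embeds.\<close>

type_synonym ('k, 'v, 'w) tensor = "('v \<Rightarrow> 'w \<Rightarrow> 'k) \<Rightarrow> 'k"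

definition tensor ::
  "('k::field \<Rightarrow> 'v::ab_group_add \<Rightarrow> 'v) \<Rightarrow> ('k \<Rightarrow> 'w::ab_group_add \<Rightarrow> 'w) \<Rightarrow> 'v \<Rightarrow> 'w \<Rightarrow> ('k, 'v, 'w) tensor" where
  "tensor sV sW v w = (\<lambda>\<beta>. if bilinear_form sV sW \<beta> then \<beta> v w else 0)"

definition tensor_space ::
  "('k::field \<Rightarrow> 'v::ab_group_add \<Rightarrow> 'v) \<Rightarrow> ('k \<Rightarrow> 'w::ab_group_add \<Rightarrow> 'w) \<Rightarrow> 'v set \<Rightarrow> 'w set
     \<Rightarrow> ('k, 'v, 'w) tensor set" where
  "tensor_space sV sW V W = module.span fscale {tensor sV sW v w | v w. v \<in> V \<and> w \<in> W}"

text \<open>The map \<open>V \<otimes> W \<rightarrow> U\<close>, \<open>\<Sum> v\<^sub>i \<otimes> w\<^sub>i \<mapsto> \<Sum> f v\<^sub>i w\<^sub>i\<close> induced by a bilinear map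
  \<open>f\<close> on \<open>V \<times> W\<close>. The presentation \<open>ps\<close> has to consist of vectors of \<open>V\<close> and \<open>W\<close>, as
  \<open>f\<close> need not be bilinear elsewhere.\<close>

definition tensor_lift ::
  "('k::field \<Rightarrow> 'v::ab_group_add \<Rightarrow> 'v) \<Rightarrow> ('k \<Rightarrow> 'w::ab_group_add \<Rightarrow> 'w) \<Rightarrow> 'v set \<Rightarrow> 'w set
     \<Rightarrow> ('v \<Rightarrow> 'w \<Rightarrow> 'u::ab_group_add) \<Rightarrow> ('k, 'v, 'w) tensor \<Rightarrow> 'u" where
  "tensor_lift sV sW V W f t =
     (SOME u. \<exists>ps. set ps \<subseteq> V \<times> W \<and> t = (\<Sum>(v, w)\<leftarrow>ps. tensor sV sW v w) \<and> u = (\<Sum>(v, w)\<leftarrow>ps. f v w))"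

definition bilinear_on ::
  "('k::field \<Rightarrow> 'v::ab_group_add \<Rightarrow> 'v) \<Rightarrow> ('k \<Rightarrow> 'w::ab_group_add \<Rightarrow> 'w) \<Rightarrow> ('k \<Rightarrow> 'u::ab_group_add \<Rightarrow> 'u)
     \<Rightarrow> 'v set \<Rightarrow> 'w set \<Rightarrow> ('v \<Rightarrow> 'w \<Rightarrow> 'u) \<Rightarrow> bool" where
  "bilinear_on sV sW sU V W f \<longleftrightarrow>
     (\<forall>v\<in>V. \<forall>v'\<in>V. \<forall>w\<in>W. f (v + v') w = f v w + f v' w) \<and>
     (\<forall>v\<in>V. \<forall>w\<in>W. \<forall>w'\<in>W. f v (w + w') = f v w + f v w') \<and>
     (\<forall>c. \<forall>v\<in>V. \<forall>w\<in>W. f (sV c v) w = sU c (f v w)) \<and>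
     (\<forall>c. \<forall>v\<in>V. \<forall>w\<in>W. f v (sW c w) = sU c (f v w))"

lemma vector_space_fscale: "vector_space fscale"
  by unfold_locales (auto simp: fscale_def fun_eq_iff algebra_simps)

lemma vector_space_field: "vector_space ((*) :: 'k::field \<Rightarrow> 'k \<Rightarrow> 'k)"
  by unfold_locales (auto simp: algebra_simps)

lemma sum_list_apply: "(\<Sum>x\<leftarrow>xs. g x) y = (\<Sum>x\<leftarrow>xs. (g x y :: 'k::field))"
  by (induction xs) auto

lemma tensor_scale:
  fixes sV :: "'k::field \<Rightarrow> 'v::ab_group_add \<Rightarrow> 'v" and sW :: "'k \<Rightarrow> 'w::ab_group_add \<Rightarrow> 'w"
  shows "tensor sV sW (sV c v) w = fscale c (tensor sV sW v w)"
proof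
  fix \<beta> :: "'v \<Rightarrow> 'w \<Rightarrow> 'k"
  show "tensor sV sW (sV c v) w \<beta> = fscale c (tensor sV sW v w) \<beta>"
  proof (cases "bilinear_form sV sW \<beta>")
    case True
    then interpret Vector_Spaces.linear sV "(*)" "\<lambda>v. \<beta> v w" by (simp add: bilinear_form_def)
    show ?thesis using True scale by (simp add: tensor_def fscale_def)
  qed (simp add: tensor_def fscale_def)
qed

lemma tensor_space_presentation:
  fixes sV :: "'k::field \<Rightarrow> 'v::ab_group_add \<Rightarrow> 'v" and sW :: "'k \<Rightarrow> 'w::ab_group_add \<Rightarrow> 'w"
  assumes "vector_space sV" "module.subspace sV V" and t: "t \<in> tensor_space sV sW V W"
  shows "\<exists>ps. set ps \<subseteq> V \<times> W \<and> t = (\<Sum>(v, w)\<leftarrow>ps. tensor sV sW v w)"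
proof -
  interpret F: vector_space "fscale :: 'k \<Rightarrow> ('k, 'v, 'w) tensor \<Rightarrow> _" by (rule vector_space_fscale)
  interpret V: vector_space sV by fact
  show ?thesis
    using t unfolding tensor_space_def
  proof (induction rule: F.span_induct_alt)
    case base
    show ?case by (rule exI[of _ "[]"]) simp
  next
    case (step c x y)
    then obtain v w ps where *: "v \<in> V" "w \<in> W" "x = tensor sV sW v w" "set ps \<subseteq> V \<times> W"
      "y = (\<Sum>(v, w)\<leftarrow>ps. tensor sV sW v w)" by auto
    moreover have "sV c v \<in> V" using assms(2) * by (auto intro: V.subspace_scale)
    ultimately show ?case
      by (intro exI[of _ "(sV c v, w) # ps"]) (auto simp: tensor_scale)
  qed
qed

lemma presentation_well_defined:
  fixes sV :: "'k::field \<Rightarrow> 'v::ab_group_add \<Rightarrow> 'v" and sW :: "'k \<Rightarrow> 'w::ab_group_add \<Rightarrow> 'w"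
    and sU :: "'k \<Rightarrow> 'u::ab_group_add \<Rightarrow> 'u"
  assumes "vector_space sV" "vector_space sW" "vector_space sU"
    and subV: "module.subspace sV V" and subW: "module.subspace sW W"
    and f: "bilinear_on sV sW sU V W f"
    and ps: "set ps \<subseteq> V \<times> W" and qs: "set qs \<subseteq> V \<times> W"
    and eq: "(\<Sum>(v, w)\<leftarrow>ps. tensor sV sW v w) = (\<Sum>(v, w)\<leftarrow>qs. tensor sV sW v w)"
  shows "(\<Sum>(v, w)\<leftarrow>ps. f v w) = (\<Sum>(v, w)\<leftarrow>qs. f v w)"
proof (rule ccontr)
  interpret V: vector_space sV by fact
  interpret W: vector_space sW by fact
  interpret U: vector_space sU by fact
  interpret K: vector_space "(*) :: 'k \<Rightarrow> 'k \<Rightarrow> 'k" by (rule vector_space_field)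
  interpret UK: vector_space_pair sU "(*) :: 'k \<Rightarrow> 'k \<Rightarrow> 'k" ..
  interpret VV: vector_space_pair sV sV ..
  interpret WW: vector_space_pair sW sW ..
  let ?u = "(\<Sum>(v, w)\<leftarrow>ps. f v w) - (\<Sum>(v, w)\<leftarrow>qs. f v w)"
  assume "\<not> ?thesis"
  then have "U.independent {?u}" by simp
  from UK.linear_independent_extend[OF this, of "\<lambda>_. 1"]
  obtain \<phi> where \<phi>: "Vector_Spaces.linear sU (*) \<phi>" "\<phi> ?u = 1" by auto
  obtain p where p: "range p \<subseteq> V" "Vector_Spaces.linear sV sV p" "\<And>v. v \<in> V \<Longrightarrow> p v = v"
    using VV.linear_exists_left_inverse_on[OF V.linear_id subV] by auto
  obtain q where q: "range q \<subseteq> W" "Vector_Spaces.linear sW sW q" "\<And>w. w \<in> W \<Longrightarrow> q w = w"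
    using WW.linear_exists_left_inverse_on[OF W.linear_id subW] by auto
  interpret \<phi>: Vector_Spaces.linear sU "(*)" \<phi> by fact
  interpret p: Vector_Spaces.linear sV sV p by fact
  interpret q: Vector_Spaces.linear sW sW q by fact
  define \<beta> where "\<beta> = (\<lambda>v w. \<phi> (f (p v) (q w)))"
  have pV: "p v \<in> V" and qW: "q w \<in> W" for v w using p q by auto
  have "bilinear_form sV sW \<beta>"
    unfolding bilinear_form_def \<beta>_def
    using f pV qW
    by (auto simp: bilinear_on_def p.add q.add p.scale q.scale \<phi>.add \<phi>.scale
        intro!: Vector_Spaces.linear.intro V.vector_space_axioms W.vector_space_axioms K.vector_space_axioms
          module_hom.intro V.module_axioms W.module_axioms K.module_axioms module_hom_axioms.intro)
  then have *: "(\<Sum>(v, w)\<leftarrow>rs. tensor sV sW v w) \<beta> = \<phi> (\<Sum>(v, w)\<leftarrow>rs. f v w)"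
    if "set rs \<subseteq> V \<times> W" for rs
    using that
    by (induction rs) (auto simp: tensor_def \<beta>_def p q \<phi>.add \<phi>.zero)
  from eq have "\<phi> (\<Sum>(v, w)\<leftarrow>ps. f v w) = \<phi> (\<Sum>(v, w)\<leftarrow>qs. f v w)"
    using *[OF ps] *[OF qs] by simp
  then show False using \<phi>(2) by (simp add: \<phi>.diff)
qed

lemma tensor_lift_presentation:
  assumes "vector_space sV" "vector_space sW" "vector_space sU"
    and "module.subspace sV V" "module.subspace sW W" "bilinear_on sV sW sU V W f"
    and "set ps \<subseteq> V \<times> W"
  shows "tensor_lift sV sW V W f (\<Sum>(v, w)\<leftarrow>ps. tensor sV sW v w) = (\<Sum>(v, w)\<leftarrow>ps. f v w)"
  unfolding tensor_lift_def
  using presentation_well_defined[OF assms(1-6)] assms(7)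
  by (intro some_equality) (blast, metis)

lemma tensor_lift_unique:
  assumes "vector_space sV" "vector_space sW" "vector_space sU"
    and "module.subspace sV V" "module.subspace sW W" "bilinear_on sV sW sU V W f"
    and additive: "\<And>s t. s \<in> tensor_space sV sW V W \<Longrightarrow> t \<in> tensor_space sV sW V W \<Longrightarrow> g (s + t) = g s + g t"
    and tensors: "\<And>v w. v \<in> V \<Longrightarrow> w \<in> W \<Longrightarrow> g (tensor sV sW v w) = f v w"
    and t: "t \<in> tensor_space sV sW V W"
  shows "g t = tensor_lift sV sW V W f t"
proof -
  interpret F: vector_space "fscale :: 'a \<Rightarrow> ('a, 'b, 'c) tensor \<Rightarrow> _" by (rule vector_space_fscale)
  have "(\<Sum>(v, w)\<leftarrow>ps. tensor sV sW v w) \<in> tensor_space sV sW V W" if "set ps \<subseteq> V \<times> W" for ps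
    using that by (induction ps) (auto simp: tensor_space_def intro!: F.span_add F.span_zero intro: F.span_base)
  moreover have "tensor sV sW v w \<in> tensor_space sV sW V W" if "v \<in> V" "w \<in> W" for v w
    using that by (auto simp: tensor_space_def intro: F.span_base)
  moreover have "g 0 = 0"
    using additive[of 0 0] by (simp add: tensor_space_def F.span_zero)
  ultimately have "g (\<Sum>(v, w)\<leftarrow>ps. tensor sV sW v w) = (\<Sum>(v, w)\<leftarrow>ps. f v w)" if "set ps \<subseteq> V \<times> W" for ps
    using that by (induction ps) (auto simp: additive tensors)
  then show ?thesis
    using tensor_space_presentation[OF assms(1,4) t] tensor_lift_presentation[OF assms(1-6)] by metis
qed

definition tensor_map ::
  "('k::field \<Rightarrow> 'v::ab_group_add \<Rightarrow> 'v) \<Rightarrow> ('k \<Rightarrow> 'w::ab_group_add \<Rightarrow> 'w)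
     \<Rightarrow> ('k \<Rightarrow> 'x::ab_group_add \<Rightarrow> 'x) \<Rightarrow> ('k \<Rightarrow> 'y::ab_group_add \<Rightarrow> 'y)
     \<Rightarrow> 'v set \<Rightarrow> 'w set \<Rightarrow> ('v \<Rightarrow> 'x) \<Rightarrow> ('w \<Rightarrow> 'y) \<Rightarrow> ('k, 'v, 'w) tensor \<Rightarrow> ('k, 'x, 'y) tensor" where
  "tensor_map sV sW sX sY V W f g = tensor_lift sV sW V W (\<lambda>v w. tensor sX sY (f v) (g w))"


section \<open>Hopf algebras\<close>

text \<open>The underlying ring is the type \<open>'h\<close>; the record carries the remaining structure.\<close>

record ('k, 'h) hopf_data =
  hscale :: "'k \<Rightarrow> 'h \<Rightarrow> 'h"
  comult :: "'h \<Rightarrow> ('k, 'h, 'h) tensor"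
  counit :: "'h \<Rightarrow> 'k"
  antipode :: "'h \<Rightarrow> 'h"

definition htensor :: "('k::field, 'h::ring_1) hopf_data \<Rightarrow> 'h \<Rightarrow> 'h \<Rightarrow> ('k, 'h, 'h) tensor" where
  "htensor H = tensor (hscale H) (hscale H)"

definition hlift ::
  "('k::field, 'h::ring_1) hopf_data \<Rightarrow> ('h \<Rightarrow> 'h \<Rightarrow> 'u::ab_group_add) \<Rightarrow> ('k, 'h, 'h) tensor \<Rightarrow> 'u" where
  "hlift H = tensor_lift (hscale H) (hscale H) UNIV UNIV"

text \<open>In the coassociativity axiom both sides live in \<open>\<H> \<otimes> (\<H> \<otimes> \<H>)\<close>:
  \<open>(\<Delta> \<otimes> id) \<Delta>(x)\<close> is transported there by the associativity isomorphism, i.e. it reads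
  \<open>\<Sum> x\<^sub>1\<^sub>1 \<otimes> (x\<^sub>1\<^sub>2 \<otimes> x\<^sub>2) = \<Sum> x\<^sub>1 \<otimes> \<Delta>(x\<^sub>2)\<close>.\<close>

locale hopf_algebra =
  fixes H :: "('k::field, 'h::ring_1) hopf_data"
  assumes vector_space_hscale: "vector_space (hscale H)"
    and hscale_mult_left: "hscale H c (x * y) = hscale H c x * y"
    and hscale_mult_right: "hscale H c (x * y) = x * hscale H c y"
    and comult_closed: "comult H x \<in> tensor_space (hscale H) (hscale H) UNIV UNIV"
    and comult_linear: "Vector_Spaces.linear (hscale H) fscale (comult H)"
    and counit_linear: "Vector_Spaces.linear (hscale H) (*) (counit H)"
    and antipode_linear: "Vector_Spaces.linear (hscale H) (hscale H) (antipode H)"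
    and coassoc:
      "hlift H (\<lambda>a b. hlift H (\<lambda>a1 a2. tensor (hscale H) fscale a1 (htensor H a2 b)) (comult H a)) (comult H x)
       = hlift H (\<lambda>a b. tensor (hscale H) fscale a (comult H b)) (comult H x)"
    and counit_left: "hlift H (\<lambda>a b. hscale H (counit H a) b) (comult H x) = x"
    and counit_right: "hlift H (\<lambda>a b. hscale H (counit H b) a) (comult H x) = x"
    and comult_mult:
      "comult H (x * y) =
       hlift H (\<lambda>a b. hlift H (\<lambda>c d. htensor H (a * c) (b * d)) (comult H y)) (comult H x)"
    and comult_one: "comult H 1 = htensor H 1 1"
    and counit_mult: "counit H (x * y) = counit H x * counit H y"
    and counit_one: "counit H 1 = 1"
    and antipode_left: "hlift H (\<lambda>a b. antipode H a * b) (comult H x) = hscale H (counit H x) 1"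
    and antipode_right: "hlift H (\<lambda>a b. a * antipode H b) (comult H x) = hscale H (counit H x) 1"


section \<open>The dual Hopf algebra\<close>

definition two_sided_ideal :: "'h::ring_1 set \<Rightarrow> bool" where
  "two_sided_ideal I \<longleftrightarrow>
     0 \<in> I \<and> (\<forall>x\<in>I. \<forall>y\<in>I. x - y \<in> I) \<and> (\<forall>x\<in>I. \<forall>r. r * x \<in> I \<and> x * r \<in> I)"

text \<open>\<open>\<H>/I\<close> is finite-dimensional: the cosets of some finite set span it.\<close>

definition cofinite_ideal :: "('k::field, 'h::ring_1) hopf_data \<Rightarrow> 'h set \<Rightarrow> bool" where
  "cofinite_ideal H I \<longleftrightarrow> two_sided_ideal I \<and>
     (\<exists>B. finite B \<and> (\<forall>x. \<exists>b\<in>module.span (hscale H) B. x - b \<in> I))"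

text \<open>\<open>(\<H>/I)\<^sup>*\<close> is identified with the functionals on \<open>\<H>\<close> that vanish on \<open>I\<close>.\<close>

definition finite_dual :: "('k::field, 'h::ring_1) hopf_data \<Rightarrow> ('h \<Rightarrow> 'k) set" where
  "finite_dual H =
     {f. Vector_Spaces.linear (hscale H) (*) f \<and> (\<exists>I. cofinite_ideal H I \<and> (\<forall>x\<in>I. f x = 0))}"

definition dual_mult :: "('k::field, 'h::ring_1) hopf_data \<Rightarrow> ('h \<Rightarrow> 'k) \<Rightarrow> ('h \<Rightarrow> 'k) \<Rightarrow> 'h \<Rightarrow> 'k" where
  "dual_mult H f g = (\<lambda>x. hlift H (\<lambda>a b. f a * g b) (comult H x))"

definition dual_one :: "('k::field, 'h::ring_1) hopf_data \<Rightarrow> 'h \<Rightarrow> 'k" where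
  "dual_one H = counit H"

definition dual_antipode :: "('k::field, 'h::ring_1) hopf_data \<Rightarrow> ('h \<Rightarrow> 'k) \<Rightarrow> 'h \<Rightarrow> 'k" where
  "dual_antipode H f = (\<lambda>x. f (antipode H x))"

text \<open>The coproduct of \<open>\<H>\<^sup>\<circ>\<close> is dual to the product: \<open>\<Sum> \<langle>f\<^sub>1, x\<rangle>\<langle>f\<^sub>2, y\<rangle> = \<langle>f, xy\<rangle>\<close>.\<close>

definition dual_comult ::
  "('k::field, 'h::ring_1) hopf_data \<Rightarrow> ('h \<Rightarrow> 'k) \<Rightarrow> ('k, 'h \<Rightarrow> 'k, 'h \<Rightarrow> 'k) tensor" where
  "dual_comult H f = (THE t. t \<in> tensor_space fscale fscale (finite_dual H) (finite_dual H) \<and>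
     (\<forall>x y. tensor_lift fscale fscale (finite_dual H) (finite_dual H) (\<lambda>a b. a x * b y) t = f (x * y)))"

definition dual_hopf_subalgebra :: "('k::field, 'h::ring_1) hopf_data \<Rightarrow> ('h \<Rightarrow> 'k) set \<Rightarrow> bool" where
  "dual_hopf_subalgebra H K \<longleftrightarrow>
     K \<subseteq> finite_dual H \<and> module.subspace fscale K \<and>
     dual_one H \<in> K \<and> (\<forall>f\<in>K. \<forall>g\<in>K. dual_mult H f g \<in> K) \<and>
     (\<forall>f\<in>K. dual_comult H f \<in> tensor_space fscale fscale K K) \<and>
     (\<forall>f\<in>K. dual_antipode H f \<in> K)"

text \<open>The action \<open>hx = \<Sum> x\<^sub>1 \<langle>x\<^sub>2, h\<rangle>\<close> of \<open>\<H>\<close> on \<open>\<H>\<^sup>\<circ>\<close>.\<close>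

definition dual_act :: "('k::field, 'h::ring_1) hopf_data \<Rightarrow> 'h \<Rightarrow> ('h \<Rightarrow> 'k) \<Rightarrow> 'h \<Rightarrow> 'k" where
  "dual_act H h x =
     tensor_lift fscale fscale (finite_dual H) (finite_dual H) (\<lambda>x1 x2. fscale (x2 h) x1) (dual_comult H x)"


section \<open>Modules\<close>

record ('k, 'h, 'v) module_data = "'v partial_object" +
  mscale :: "'k \<Rightarrow> 'v \<Rightarrow> 'v"
  act :: "'h \<Rightarrow> 'v \<Rightarrow> 'v"

locale left_H_module = hopf_algebra H
  for H :: "('k::field, 'h::ring_1) hopf_data" +
  fixes M :: "('k, 'h, 'v::ab_group_add) module_data"
  assumes vector_space_mscale: "vector_space (mscale M)"
    and subspace_carrier: "module.subspace (mscale M) (carrier M)"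
    and act_closed: "v \<in> carrier M \<Longrightarrow> act M h v \<in> carrier M"
    and act_add_right: "v \<in> carrier M \<Longrightarrow> w \<in> carrier M \<Longrightarrow> act M h (v + w) = act M h v + act M h w"
    and act_add_left: "v \<in> carrier M \<Longrightarrow> act M (g + h) v = act M g v + act M h v"
    and act_mult: "v \<in> carrier M \<Longrightarrow> act M (g * h) v = act M g (act M h v)"
    and act_one: "v \<in> carrier M \<Longrightarrow> act M 1 v = v"
    and act_hscale: "v \<in> carrier M \<Longrightarrow> act M (hscale H c h) v = mscale M c (act M h v)"

definition ordered_basis :: "('k::field, 'h, 'v::ab_group_add) module_data \<Rightarrow> 'v list \<Rightarrow> bool" where
  "ordered_basis M bs \<longleftrightarrow> distinct bs \<and> set bs \<subseteq> carrier M \<and>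
     \<not> module.dependent (mscale M) (set bs) \<and> module.span (mscale M) (set bs) = carrier M"

text \<open>\<open>h b\<^sub>j = \<Sum>\<^sub>i \<pi>(h)\<^sub>i\<^sub>j b\<^sub>i\<close>\<close>

definition matrix_rep :: "('k::field, 'h, 'v::ab_group_add) module_data \<Rightarrow> 'v list \<Rightarrow> 'h \<Rightarrow> 'k mat" where
  "matrix_rep M bs h = mat (length bs) (length bs)
     (\<lambda>(i, j). module.representation (mscale M) (set bs) (act M h (bs ! j)) (bs ! i))"

definition tensor_module ::
  "('k::field, 'h::ring_1) hopf_data \<Rightarrow> ('k, 'h, 'v::ab_group_add) module_data
     \<Rightarrow> ('k, 'h, 'w::ab_group_add) module_data \<Rightarrow> ('k, 'h, ('k, 'v, 'w) tensor) module_data" where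
  "tensor_module H M N = \<lparr>
     carrier = tensor_space (mscale M) (mscale N) (carrier M) (carrier N),
     mscale = fscale,
     act = (\<lambda>h t. hlift H (\<lambda>h1 h2. tensor_map (mscale M) (mscale N) (mscale M) (mscale N)
              (carrier M) (carrier N) (act M h1) (act N h2) t) (comult H h))\<rparr>"

definition direct_sum_copies ::
  "'j set \<Rightarrow> ('k, 'h, 'v::ab_group_add) module_data \<Rightarrow> ('k, 'h, 'j \<Rightarrow> 'v) module_data" where
  "direct_sum_copies J N = \<lparr>
     carrier = {F. (\<forall>j\<in>J. F j \<in> carrier N) \<and> (\<forall>j. j \<notin> J \<longrightarrow> F j = 0) \<and> finite {j. F j \<noteq> 0}},
     mscale = (\<lambda>c F j. mscale N c (F j)),
     act = (\<lambda>h F j. if j \<in> J then act N h (F j) else 0)\<rparr>"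

definition module_isomorphic ::
  "('k, 'h, 'v::ab_group_add) module_data \<Rightarrow> ('k, 'h, 'w::ab_group_add) module_data \<Rightarrow> bool" where
  "module_isomorphic M N \<longleftrightarrow> (\<exists>\<Phi>. bij_betw \<Phi> (carrier M) (carrier N) \<and>
     (\<forall>v\<in>carrier M. \<forall>w\<in>carrier M. \<Phi> (v + w) = \<Phi> v + \<Phi> w) \<and>
     (\<forall>c. \<forall>v\<in>carrier M. \<Phi> (mscale M c v) = mscale N c (\<Phi> v)) \<and>
     (\<forall>h. \<forall>v\<in>carrier M. \<Phi> (act M h v) = act N h (\<Phi> v)))"

text \<open>The index set may be taken inside the type of \<open>M \<otimes> R\<close> without loss of generality:
  for \<open>R \<noteq> 0\<close> it injects into \<open>\<Oplus>\<^sub>J R \<cong> M \<otimes> R\<close>, and for \<open>R = 0\<close> it is irrelevant.\<close>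

definition trivialized_by ::
  "('k::field, 'h::ring_1) hopf_data \<Rightarrow> ('k, 'h, 'v::ab_group_add) module_data
     \<Rightarrow> ('k, 'h, 'w::ab_group_add) module_data \<Rightarrow> bool" where
  "trivialized_by H M R \<longleftrightarrow>
     (\<exists>J :: ('k, 'v, 'w) tensor set. module_isomorphic (tensor_module H M R) (direct_sum_copies J R))"


section \<open>The co-representation Hopf algebra\<close>

definition matrix_functional :: "nat \<Rightarrow> ('k::field mat \<Rightarrow> 'k) \<Rightarrow> bool" where
  "matrix_functional n \<phi> \<longleftrightarrow>
     (\<forall>A\<in>carrier_mat n n. \<forall>B\<in>carrier_mat n n. \<phi> (A + B) = \<phi> A + \<phi> B) \<and>
     (\<forall>c. \<forall>A\<in>carrier_mat n n. \<phi> (c \<cdot>\<^sub>m A) = c * \<phi> A)"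

definition coefficient_coalgebra :: "nat \<Rightarrow> ('h \<Rightarrow> 'k::field mat) \<Rightarrow> ('h \<Rightarrow> 'k) set" where
  "coefficient_coalgebra n \<pi> = {\<phi> \<circ> \<pi> | \<phi>. matrix_functional n \<phi>}"

text \<open>Over a field, \<open>\<Inter>(K \<otimes> K) = (\<Inter>K) \<otimes> (\<Inter>K)\<close>, so this intersection is itself a
  Hopf subalgebra of \<open>\<H>\<^sup>\<circ>\<close>, the smallest one containing the coefficients.\<close>

definition corep_hopf_algebra ::
  "('k::field, 'h::ring_1) hopf_data \<Rightarrow> nat \<Rightarrow> ('h \<Rightarrow> 'k mat) \<Rightarrow> ('h \<Rightarrow> 'k) set" where
  "corep_hopf_algebra H n \<pi> = \<Inter>{K. dual_hopf_subalgebra H K \<and> coefficient_coalgebra n \<pi> \<subseteq> K}"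

definition corep_module ::
  "('k::field, 'h::ring_1) hopf_data \<Rightarrow> nat \<Rightarrow> ('h \<Rightarrow> 'k mat) \<Rightarrow> ('k, 'h, 'h \<Rightarrow> 'k) module_data" where
  "corep_module H n \<pi> = \<lparr>carrier = corep_hopf_algebra H n \<pi>, mscale = fscale, act = dual_act H\<rparr>"

definition dual_right_ideal :: "('k::field, 'h::ring_1) hopf_data \<Rightarrow> ('h \<Rightarrow> 'k) set \<Rightarrow> ('h \<Rightarrow> 'k) set \<Rightarrow> bool" where
  "dual_right_ideal H R I \<longleftrightarrow> I \<subseteq> R \<and> 0 \<in> I \<and> (\<forall>x\<in>I. \<forall>y\<in>I. x - y \<in> I) \<and>
     (\<forall>x\<in>I. \<forall>r\<in>R. dual_mult H x r \<in> I)"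

definition dual_ideal :: "('k::field, 'h::ring_1) hopf_data \<Rightarrow> ('h \<Rightarrow> 'k) set \<Rightarrow> ('h \<Rightarrow> 'k) set \<Rightarrow> bool" where
  "dual_ideal H R I \<longleftrightarrow> dual_right_ideal H R I \<and> (\<forall>x\<in>I. \<forall>r\<in>R. dual_mult H r x \<in> I)"

definition act_stable :: "('k, 'h, 'v) module_data \<Rightarrow> 'v set \<Rightarrow> bool" where
  "act_stable M I \<longleftrightarrow> (\<forall>h. \<forall>x\<in>I. act M h x \<in> I)"

end

theory Submission
  imports Defs
begin

text \<open>Write \<open>R\<close> for the co-representation algebra and, for \<open>f\<close> in \<open>\<H>\<^sup>\<circ>\<close>, call the
functions \<open>x \<mapsto> f (x * h)\<close> and \<open>x \<mapsto> f (h * x)\<close> the right and the left translates of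
\<open>f\<close>. The right translates form the orbit of \<open>f\<close> under \<open>\<H>\<close> (\<open>dual_act_apply\<close>). All that is used about \<open>R\<close> is that it is
a unital subalgebra of \<open>\<H>\<^sup>\<circ>\<close> that is stable under the antipode and under both kinds of
translation, and that it contains the matrix coefficients of \<open>M\<close>. Stability under
translation is closure under the coproduct expressed without tensors; it visibly passes to
the intersection that defines \<open>R\<close>. That
\<open>\<H>\<^sup>\<circ>\<close> itself is a Hopf algebra, so that \<open>R\<close> is an intersection of a non-empty family,
rests on the antipode being anti-multiplicative (\<open>antipode_mult\<close>) and on the
description of \<open>\<H>\<^sup>\<circ>\<close> as the functionals \<open>f\<close> for which \<open>f (x * y)\<close> is a finite sum
of products \<open>a x * b y\<close> (\<open>finite_dual_iff\<close>).

Simplicity (\<open>stable_right_ideal_trivial\<close>): a non-zero stable right ideal \<open>I\<close> contains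
some \<open>g\<close> with \<open>g 1 \<noteq> 0\<close>, namely a suitable translate of any non-zero element. In the coproduct
\<open>\<Sum> g\<^sub>1 \<otimes> g\<^sub>2\<close> the left factors can be chosen among the right translates of \<open>g\<close>, hence in
\<open>I\<close>, and the right factors in the span of the left translates, hence in \<open>R\<close>
(\<open>skeleton_decomposition\<close>). Then \<open>\<Sum> g\<^sub>1 S(g\<^sub>2)\<close>, which is \<open>g 1\<close> times the unit, lies in
\<open>I\<close>, so \<open>I\<close> is everything.

Trivialization (\<open>trivialized\<close>): let \<open>b\<^sub>i\<close> be the basis of \<open>M\<close> and let \<open>c\<^sub>j v\<close> be the
functional giving the \<open>j\<close>-th coordinate of \<open>h v\<close> at \<open>h\<close>. The map
\<open>v \<otimes> f \<mapsto> (c\<^sub>j v * f)\<^sub>j\<close> from \<open>M \<otimes> R\<close> to \<open>R\<^sup>n\<close> is equivariant because the coproduct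
of \<open>\<H>\<close> is multiplicative (\<open>twist_equivariant\<close>). It is multiplication by the matrix
\<open>(c\<^sub>j b\<^sub>i)\<close> over \<open>R\<close>, whose inverse is obtained by applying the antipode to each entry.\<close>

section \<open>Functions of two variables of finite rank\<close>

interpretation fun_vs: vector_space "fscale :: 'k::field \<Rightarrow> ('a \<Rightarrow> 'k) \<Rightarrow> _"
  by (rule vector_space_fscale)

lemma fscale_apply: "fscale c f x = c * f x"
  by (simp add: fscale_def)

lemma sum_apply: "(\<Sum>x\<in>A. g x) y = (\<Sum>x\<in>A. g x y)"
  by (induction A rule: infinite_finite_induct) auto

lemma sum_list_cong: "(\<And>x. x \<in> set xs \<Longrightarrow> f x = g x) \<Longrightarrow> (\<Sum>x\<leftarrow>xs. f x) = (\<Sum>x\<leftarrow>xs. g x)"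
  by (induction xs) auto

lemma additive_sum_list:
  fixes \<phi> :: "'u::ab_group_add \<Rightarrow> 'w::ab_group_add"
  assumes "\<And>u v. \<phi> (u + v) = \<phi> u + \<phi> v"
  shows "\<phi> (\<Sum>x\<leftarrow>xs. g x) = (\<Sum>x\<leftarrow>xs. \<phi> (g x))"
proof -
  have "\<phi> 0 = 0" using assms[of 0 0] by simp
  then show ?thesis by (induction xs) (simp_all add: assms)
qed

lemma sum_list_product:
  "(\<Sum>p\<leftarrow>ps. u p) * (\<Sum>q\<leftarrow>qs. v q) = (\<Sum>(p, q)\<leftarrow>List.product ps qs. u p * v q :: 'k::ring)"
  by (induction ps) (simp_all add: distrib_right sum_list_const_mult o_def)

lemma sum_list_swap: "(\<Sum>x\<leftarrow>xs. \<Sum>y\<in>A. g x y) = (\<Sum>y\<in>A. \<Sum>x\<leftarrow>xs. g x y)"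
  by (induction xs) (auto simp: sum.distrib)

text \<open>A matrix of finite rank factors through a finite set of its own columns. The point is that
the coefficient functions then lie in the span of its rows: applied to \<open>f (x * y)\<close>, this
places both tensor factors of the coproduct of \<open>f\<close> in spaces spanned by translates
of \<open>f\<close>.\<close>

lemma skeleton_decomposition:
  fixes F :: "'a \<Rightarrow> 'b \<Rightarrow> 'k::field"
  assumes F: "\<And>x y. F x y = (\<Sum>(a, b)\<leftarrow>ps. a x * b y)"
  obtains qs where "set qs \<subseteq> range (\<lambda>y x. F x y) \<times> fun_vs.span (range F)"
    and "\<And>x y. F x y = (\<Sum>(a, b)\<leftarrow>qs. a x * b y)"
proof -
  let ?C = "range (\<lambda>y x. F x y)"
  let ?E = "fun_vs.span (range F)"
  have "(\<Sum>(a, b)\<leftarrow>rs. fscale (b y) a) \<in> fun_vs.span (fst ` set rs)"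
    for rs :: "(('a \<Rightarrow> 'k) \<times> ('b \<Rightarrow> 'k)) list" and y
  proof (induction rs)
    case (Cons r rs)
    have "fun_vs.span (fst ` set rs) \<subseteq> fun_vs.span (fst ` set (r # rs))"
      by (rule fun_vs.span_mono) auto
    moreover have "fscale (snd r y) (fst r) \<in> fun_vs.span (fst ` set (r # rs))"
      by (intro fun_vs.span_scale fun_vs.span_base) simp
    ultimately have "fscale (snd r y) (fst r) + (\<Sum>(a, b)\<leftarrow>rs. fscale (b y) a)
      \<in> fun_vs.span (fst ` set (r # rs))"
      using Cons by (intro fun_vs.span_add) auto
    then show ?case by (simp only: list.map sum_list.Cons case_prod_unfold)
  qed (simp only: list.map sum_list.Nil fun_vs.span_zero)
  moreover have "(\<lambda>x. F x y) = (\<Sum>(a, b)\<leftarrow>ps. fscale (b y) a)" for y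
    by (rule ext) (simp add: fscale_apply F sum_list_apply case_prod_unfold mult.commute)
  ultimately have C: "?C \<subseteq> fun_vs.span (fst ` set ps)" by auto
  obtain B where B: "B \<subseteq> ?C" "fun_vs.independent B" "?C \<subseteq> fun_vs.span B"
    using fun_vs.maximal_independent_subset by blast
  have fin: "finite B"
    using fun_vs.independent_span_bound[of "fst ` set ps" B] B C by auto
  define c where "c w y = fun_vs.representation B (\<lambda>x. F x y) w" for w y
  have dec: "F x y = (\<Sum>w\<in>B. w x * c w y)" for x y
  proof -
    have "(\<Sum>w\<in>B. fscale (c w y) w) = (\<lambda>x. F x y)"
      unfolding c_def using fun_vs.sum_representation_eq[OF B(2) _ fin order.refl] B(3) by blast
    then have "(\<Sum>w\<in>B. fscale (c w y) w) x = F x y" by (rule fun_cong)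
    then show ?thesis by (simp add: fscale_apply sum_apply mult.commute)
  qed
  interpret EE: vector_space_pair "fscale :: 'k \<Rightarrow> ('b \<Rightarrow> 'k) \<Rightarrow> _" "fscale :: 'k \<Rightarrow> ('b \<Rightarrow> 'k) \<Rightarrow> _" ..
  \<comment> \<open>A projection onto the row space fixes each row, hence, the columns in \<open>B\<close> being
    independent, each coefficient function.\<close>
  obtain q where q: "range q \<subseteq> ?E" "Vector_Spaces.linear fscale fscale q" "\<And>w. w \<in> ?E \<Longrightarrow> q w = w"
    using EE.linear_exists_left_inverse_on[OF fun_vs.linear_id fun_vs.subspace_span[of "range F"]] by auto
  interpret q: Vector_Spaces.linear fscale fscale q by fact
  have cE: "c w \<in> ?E" if "w \<in> B" for w
  proof -
    have "c w y - q (c w) y = 0" for y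
    proof (rule fun_vs.independentD[OF B(2) fin order.refl _ \<open>w \<in> B\<close>])
      show "(\<Sum>v\<in>B. fscale (c v y - q (c v) y) v) = 0"
      proof
        fix x
        have row: "F x = (\<Sum>v\<in>B. fscale (v x) (c v))"
          by (rule ext) (simp add: fscale_apply sum_apply dec)
        have "q (F x) = F x" by (rule q(3)) (simp add: fun_vs.span_base)
        then have "(\<Sum>v\<in>B. fscale (v x) (q (c v))) = (\<Sum>v\<in>B. fscale (v x) (c v))"
          by (simp add: row q.sum q.scale)
        then have "(\<Sum>v\<in>B. fscale (v x) (q (c v))) y = (\<Sum>v\<in>B. fscale (v x) (c v)) y" by simp
        then show "(\<Sum>v\<in>B. fscale (c v y - q (c v) y) v) x = 0 x"
          by (simp add: fscale_apply sum_apply left_diff_distrib right_diff_distrib sum_subtractf mult.commute)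
      qed
    qed
    then have "c w = q (c w)" by (auto simp: fun_eq_iff)
    then show ?thesis using q(1) by (metis range_subsetD)
  qed
  obtain ws where ws: "set ws = B" "distinct ws" using fin finite_distinct_list by blast
  show thesis
  proof (rule that[of "map (\<lambda>w. (w, c w)) ws"])
    show "set (map (\<lambda>w. (w, c w)) ws) \<subseteq> ?C \<times> ?E" using ws(1) B(1) cE by auto
    show "F x y = (\<Sum>(a, b)\<leftarrow>map (\<lambda>w. (w, c w)) ws. a x * b y)" for x y
      unfolding dec by (simp add: ws(1)[symmetric] sum.distinct_set_conv_list[OF ws(2)] o_def)
  qed
qed

section \<open>Tensors and the maps induced by bilinear maps\<close>

lemma tensor_add_left: "tensor sV sW (v + v') w = tensor sV sW v w + tensor sV sW v' w"
proof
  fix \<beta>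
  show "tensor sV sW (v + v') w \<beta> = (tensor sV sW v w + tensor sV sW v' w) \<beta>"
  proof (cases "bilinear_form sV sW \<beta>")
    case True
    then interpret Vector_Spaces.linear sV "(*)" "\<lambda>v. \<beta> v w" by (simp add: bilinear_form_def)
    show ?thesis using True add by (simp add: tensor_def)
  qed (simp add: tensor_def)
qed

lemma tensor_add_right: "tensor sV sW v (w + w') = tensor sV sW v w + tensor sV sW v w'"
proof
  fix \<beta>
  show "tensor sV sW v (w + w') \<beta> = (tensor sV sW v w + tensor sV sW v w') \<beta>"
  proof (cases "bilinear_form sV sW \<beta>")
    case True
    then interpret Vector_Spaces.linear sW "(*)" "\<beta> v" by (simp add: bilinear_form_def)
    show ?thesis using True add by (simp add: tensor_def)
  qed (simp add: tensor_def)
qed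

lemma tensor_scale_right: "tensor sV sW v (sW c w) = fscale c (tensor sV sW v w)"
proof
  fix \<beta>
  show "tensor sV sW v (sW c w) \<beta> = fscale c (tensor sV sW v w) \<beta>"
  proof (cases "bilinear_form sV sW \<beta>")
    case True
    then interpret Vector_Spaces.linear sW "(*)" "\<beta> v" by (simp add: bilinear_form_def)
    show ?thesis using True scale by (simp add: tensor_def fscale_apply)
  qed (simp add: tensor_def fscale_apply)
qed

lemma tensor_zero_left: "tensor sV sW 0 w = 0"
  using tensor_add_left[of sV sW 0 0 w] by simp

lemma tensor_zero_right: "tensor sV sW v 0 = 0"
  using tensor_add_right[of sV sW v 0 0] by simp

lemma tensor_minus_left: "tensor sV sW (- v) w = - tensor sV sW v w"
  using tensor_add_left[of sV sW "- v" v w]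
  by (simp add: tensor_zero_left eq_neg_iff_add_eq_0)

lemma tensor_sum_left: "tensor sV sW (\<Sum>x\<in>A. g x) w = (\<Sum>x\<in>A. tensor sV sW (g x) w)"
  by (induction A rule: infinite_finite_induct) (auto simp: tensor_zero_left tensor_add_left)

lemma tensor_sum_right: "tensor sV sW v (\<Sum>x\<in>A. g x) = (\<Sum>x\<in>A. tensor sV sW v (g x))"
  by (induction A rule: infinite_finite_induct) (auto simp: tensor_zero_right tensor_add_right)

lemma tensor_sum_list_left:
  "tensor sV sW (\<Sum>x\<leftarrow>xs. g x) w = (\<Sum>x\<leftarrow>xs. tensor sV sW (g x) w)"
  by (induction xs) (auto simp: tensor_zero_left tensor_add_left)

lemma tensor_presentation_in_space:
  assumes "set ps \<subseteq> V \<times> W"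
  shows "(\<Sum>(v, w)\<leftarrow>ps. tensor sV sW v w) \<in> tensor_space sV sW V W"
  using assms
  by (induction ps)
    (auto simp: tensor_space_def intro!: fun_vs.span_add fun_vs.span_zero intro: fun_vs.span_base)

text \<open>The tensor product of two function spaces embeds into the functions of two variables:
expand the second factors in a basis \<open>B\<close>; for fixed \<open>x\<close>, independence of \<open>B\<close> makes the
collected first factors vanish at \<open>x\<close>. This is what determines a coproduct in the dual by
its values.\<close>

lemma function_tensor_eq_0:
  fixes ps :: "(('a \<Rightarrow> 'k::field) \<times> ('b \<Rightarrow> 'k)) list"
  assumes zero: "\<And>x y. (\<Sum>(a, b)\<leftarrow>ps. a x * b y) = 0"
  shows "(\<Sum>(a, b)\<leftarrow>ps. tensor fscale fscale a b) = 0"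
proof -
  obtain B where B: "B \<subseteq> snd ` set ps" "fun_vs.independent B" "snd ` set ps \<subseteq> fun_vs.span B"
    using fun_vs.maximal_independent_subset by blast
  have fin: "finite B" using B(1) finite_subset by blast
  define r where "r b w = fun_vs.representation B b w" for b w
  have r: "(\<Sum>w\<in>B. fscale (r b w) w) = b" if "b \<in> snd ` set ps" for b
    unfolding r_def using fun_vs.sum_representation_eq[OF B(2) _ fin order.refl] B(3) that by blast
  have coeff: "(\<Sum>(a, b)\<leftarrow>ps. fscale (r b w) a) = 0" if "w \<in> B" for w
  proof
    fix x
    have "(\<Sum>(a, b)\<leftarrow>ps. a x * r b w) = 0"
    proof (rule fun_vs.independentD[OF B(2) fin order.refl _ that])
      show "(\<Sum>w\<in>B. fscale (\<Sum>(a, b)\<leftarrow>ps. a x * r b w) w) = 0"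
      proof
        fix y
        have "(\<Sum>w\<in>B. fscale (\<Sum>(a, b)\<leftarrow>ps. a x * r b w) w) y
          = (\<Sum>(a, b)\<leftarrow>ps. a x * (\<Sum>w\<in>B. fscale (r b w) w) y)"
          by (simp add: fscale_apply sum_apply sum_list_mult_const[symmetric] sum_list_swap[symmetric]
              sum_distrib_left case_prod_unfold mult.assoc)
        also have "\<dots> = (\<Sum>(a, b)\<leftarrow>ps. a x * b y)"
          using r by (intro arg_cong[where f = sum_list] map_cong refl) force
        finally show "(\<Sum>w\<in>B. fscale (\<Sum>(a, b)\<leftarrow>ps. a x * r b w) w) y = 0 y" using zero by simp
      qed
    qed
    then show "(\<Sum>(a, b)\<leftarrow>ps. fscale (r b w) a) x = 0 x"
      by (simp add: fscale_apply sum_list_apply case_prod_unfold mult.commute)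
  qed
  have "(\<Sum>(a, b)\<leftarrow>ps. tensor fscale fscale a b)
    = (\<Sum>(a, b)\<leftarrow>ps. tensor fscale fscale a (\<Sum>w\<in>B. fscale (r b w) w))"
    using r by (intro arg_cong[where f = sum_list] map_cong refl) force
  also have "\<dots> = (\<Sum>w\<in>B. tensor fscale fscale (\<Sum>(a, b)\<leftarrow>ps. fscale (r b w) a) w)"
    by (simp add: tensor_sum_right tensor_sum_list_left tensor_scale tensor_scale_right
        sum_list_swap case_prod_unfold)
  also have "\<dots> = 0" using coeff by (simp add: tensor_zero_left)
  finally show ?thesis .
qed

locale bilinear_map_on =
  fixes sV :: "'k::field \<Rightarrow> 'v::ab_group_add \<Rightarrow> 'v" and sW :: "'k \<Rightarrow> 'w::ab_group_add \<Rightarrow> 'w"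
    and sU :: "'k \<Rightarrow> 'u::ab_group_add \<Rightarrow> 'u" and V W f
  assumes vector_spaces: "vector_space sV" "vector_space sW" "vector_space sU"
    and subspaces: "module.subspace sV V" "module.subspace sW W"
    and bilinear: "bilinear_on sV sW sU V W f"
begin

lemma lift_presentation:
  "set ps \<subseteq> V \<times> W \<Longrightarrow>
    tensor_lift sV sW V W f (\<Sum>(v, w)\<leftarrow>ps. tensor sV sW v w) = (\<Sum>(v, w)\<leftarrow>ps. f v w)"
  by (rule tensor_lift_presentation[OF vector_spaces subspaces bilinear])

lemma presentation:
  assumes "t \<in> tensor_space sV sW V W"
  obtains ps where "set ps \<subseteq> V \<times> W" "t = (\<Sum>(v, w)\<leftarrow>ps. tensor sV sW v w)"
  using tensor_space_presentation[OF vector_spaces(1) subspaces(1) assms] by blast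

lemma lift_tensor: "v \<in> V \<Longrightarrow> w \<in> W \<Longrightarrow> tensor_lift sV sW V W f (tensor sV sW v w) = f v w"
  using lift_presentation[of "[(v, w)]"] by simp

lemma lift_add:
  assumes "s \<in> tensor_space sV sW V W" "t \<in> tensor_space sV sW V W"
  shows "tensor_lift sV sW V W f (s + t) = tensor_lift sV sW V W f s + tensor_lift sV sW V W f t"
proof -
  obtain ps qs where "set ps \<subseteq> V \<times> W" "s = (\<Sum>(v, w)\<leftarrow>ps. tensor sV sW v w)"
    "set qs \<subseteq> V \<times> W" "t = (\<Sum>(v, w)\<leftarrow>qs. tensor sV sW v w)"
    using presentation assms by metis
  then show ?thesis
    using lift_presentation[of ps] lift_presentation[of qs] lift_presentation[of "ps @ qs"] by simp
qed

lemma lift_sum_list: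
  assumes "\<And>x. x \<in> set xs \<Longrightarrow> g x \<in> tensor_space sV sW V W"
  shows "tensor_lift sV sW V W f (\<Sum>x\<leftarrow>xs. g x) = (\<Sum>x\<leftarrow>xs. tensor_lift sV sW V W f (g x))
    \<and> (\<Sum>x\<leftarrow>xs. g x) \<in> tensor_space sV sW V W"
  using assms
proof (induction xs)
  case Nil
  show ?case
    using lift_presentation[of "[]"] tensor_presentation_in_space[of "[]" V W sV sW]
    by (simp only: list.map sum_list.Nil list.set empty_subsetI simp_thms)
next
  case (Cons x xs)
  then have *: "g x \<in> tensor_space sV sW V W" "(\<Sum>x\<leftarrow>xs. g x) \<in> tensor_space sV sW V W"
    "tensor_lift sV sW V W f (\<Sum>x\<leftarrow>xs. g x) = (\<Sum>x\<leftarrow>xs. tensor_lift sV sW V W f (g x))" by auto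
  have "g x + (\<Sum>x\<leftarrow>xs. g x) \<in> tensor_space sV sW V W"
    using * unfolding tensor_space_def by (intro fun_vs.span_add)
  then show ?case using lift_add[OF *(1,2)] *(3) by (simp only: list.map sum_list.Cons simp_thms)
qed

lemma lift_scale:
  assumes "t \<in> tensor_space sV sW V W"
  shows "tensor_lift sV sW V W f (fscale c t) = sU c (tensor_lift sV sW V W f t)"
proof -
  interpret sV: vector_space sV by (rule vector_spaces)
  interpret sU: vector_space sU by (rule vector_spaces)
  obtain ps where ps: "set ps \<subseteq> V \<times> W" "t = (\<Sum>(v, w)\<leftarrow>ps. tensor sV sW v w)"
    using presentation assms by metis
  let ?qs = "map (\<lambda>(v, w). (sV c v, w)) ps"
  have "set ?qs \<subseteq> V \<times> W" using ps(1) subspaces(1) by (auto intro: sV.subspace_scale)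
  moreover have "fscale c t = (\<Sum>(v, w)\<leftarrow>?qs. tensor sV sW v w)"
    by (simp add: ps(2) additive_sum_list[of "fscale c"] fun_vs.scale_right_distrib
        case_prod_unfold o_def tensor_scale)
  moreover have "(\<Sum>(v, w)\<leftarrow>?qs. f v w) = sU c (\<Sum>(v, w)\<leftarrow>ps. f v w)"
    unfolding additive_sum_list[of "sU c", OF sU.scale_right_distrib] map_map
    using ps(1) bilinear by (intro sum_list_cong) (auto simp: bilinear_on_def)
  ultimately show ?thesis using lift_presentation[of ?qs] lift_presentation[of ps] ps by simp
qed

end

section \<open>Sums over the coproduct\<close>

context hopf_algebra
begin

sublocale hs: vector_space "hscale H" by (rule vector_space_hscale)

text \<open>Linearity spelled out as two equations, so that the side conditions of the calculations
below are settled by rewriting.\<close>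

definition hlinear :: "('k \<Rightarrow> 'u::ab_group_add \<Rightarrow> 'u) \<Rightarrow> ('h \<Rightarrow> 'u) \<Rightarrow> bool" where
  "hlinear sU f \<longleftrightarrow> (\<forall>x y. f (x + y) = f x + f y) \<and> (\<forall>c x. f (hscale H c x) = sU c (f x))"

lemma hlinear_iff:
  assumes "vector_space sU"
  shows "Vector_Spaces.linear (hscale H) sU f \<longleftrightarrow> hlinear sU f"
proof -
  interpret U: vector_space sU by fact
  show ?thesis
    by (simp add: Vector_Spaces.linear_def assms vector_space_hscale module_hom_def
        module_hom_axioms_def hlinear_def hs.module_axioms U.module_axioms)
qed

definition hbilinear :: "('k \<Rightarrow> 'u::ab_group_add \<Rightarrow> 'u) \<Rightarrow> ('h \<Rightarrow> 'h \<Rightarrow> 'u) \<Rightarrow> bool" where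
  "hbilinear sU F \<longleftrightarrow> (\<forall>a. hlinear sU (F a)) \<and> (\<forall>b. hlinear sU (\<lambda>a. F a b))"

lemma bilinear_map_onI:
  assumes "vector_space sU" "hbilinear sU F"
  shows "bilinear_map_on (hscale H) (hscale H) sU UNIV UNIV F"
  using assms
  by unfold_locales (auto simp: bilinear_on_def hbilinear_def hlinear_def vector_space_hscale
      vector_space_def module_def)

text \<open>An arbitrary fixed presentation \<open>\<Sum> x\<^sub>1 \<otimes> x\<^sub>2\<close> of the coproduct of \<open>x\<close>. The sum
\<open>sweedler F x = \<Sum> F x\<^sub>1 x\<^sub>2\<close> is independent of it when \<open>F\<close> is bilinear, by
\<open>hlift_comult\<close> below; being an ordinary finite sum, it can be exchanged with other sums
whatever \<open>F\<close> is.\<close>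

definition coproduct_pairs :: "'h \<Rightarrow> ('h \<times> 'h) list" where
  "coproduct_pairs x = (SOME ps. comult H x = (\<Sum>(a, b)\<leftarrow>ps. htensor H a b))"

definition sweedler :: "('h \<Rightarrow> 'h \<Rightarrow> 'u::ab_group_add) \<Rightarrow> 'h \<Rightarrow> 'u" where
  "sweedler F x = (\<Sum>(a, b)\<leftarrow>coproduct_pairs x. F a b)"

lemma comult_sweedler: "comult H x = sweedler (htensor H) x"
  unfolding sweedler_def coproduct_pairs_def htensor_def
  by (rule someI_ex)
    (use tensor_space_presentation[OF vector_space_hscale hs.subspace_UNIV comult_closed] in blast)

lemma hlift_comult:
  assumes "vector_space sU" "hbilinear sU F"
  shows "hlift H F (comult H x) = sweedler F x"
  unfolding hlift_def comult_sweedler sweedler_def htensor_def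
  by (rule bilinear_map_on.lift_presentation[OF bilinear_map_onI[OF assms]]) simp

lemma sweedler_add_arg:
  assumes "vector_space sU" "hbilinear sU F"
  shows "sweedler F (x + y) = sweedler F x + sweedler F y"
proof -
  interpret bilinear_map_on "hscale H" "hscale H" sU UNIV UNIV F by (rule bilinear_map_onI[OF assms])
  have "comult H (x + y) = comult H x + comult H y"
    using comult_linear by (simp add: hlinear_iff vector_space_fscale hlinear_def)
  then show ?thesis
    using lift_add[OF comult_closed comult_closed]
    by (simp add: hlift_comult[OF assms, symmetric] hlift_def)
qed

lemma sweedler_scale_arg:
  assumes "vector_space sU" "hbilinear sU F"
  shows "sweedler F (hscale H c x) = sU c (sweedler F x)"
proof -
  interpret bilinear_map_on "hscale H" "hscale H" sU UNIV UNIV F by (rule bilinear_map_onI[OF assms])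
  have "comult H (hscale H c x) = fscale c (comult H x)"
    using comult_linear by (simp add: hlinear_iff vector_space_fscale hlinear_def)
  then show ?thesis
    using lift_scale[OF comult_closed] by (simp add: hlift_comult[OF assms, symmetric] hlift_def)
qed

lemma additive_sweedler:
  fixes \<phi> :: "'u::ab_group_add \<Rightarrow> 'w::ab_group_add"
  assumes "\<And>u v. \<phi> (u + v) = \<phi> u + \<phi> v"
  shows "\<phi> (sweedler F x) = sweedler (\<lambda>a b. \<phi> (F a b)) x"
  by (simp add: sweedler_def additive_sum_list[of \<phi>, OF assms] case_prod_unfold)

lemma sweedler_add: "sweedler (\<lambda>a b. F a b + G a b) x = sweedler F x + sweedler G x"
  by (simp add: sweedler_def case_prod_unfold sum_list_addf)

lemma sweedler_scale:
  assumes "vector_space sU"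
  shows "sweedler (\<lambda>a b. sU c (F a b)) x = sU c (sweedler F x)"
proof -
  interpret vector_space sU by fact
  show ?thesis by (simp add: additive_sweedler scale_right_distrib)
qed

lemma hbilinear_sum_list:
  assumes "vector_space sU" "\<And>p. p \<in> set ps \<Longrightarrow> hbilinear sU (F p)"
  shows "hbilinear sU (\<lambda>a b. \<Sum>p\<leftarrow>ps. F p a b)"
proof -
  interpret vector_space sU by fact
  show ?thesis
    using assms(2)
    by (induction ps) (auto simp: hbilinear_def hlinear_def scale_right_distrib add_ac)
qed

lemma sweedler_swap:
  fixes G :: "'h \<Rightarrow> 'h \<Rightarrow> 'h \<Rightarrow> 'h \<Rightarrow> 'u::ab_group_add"
  shows "sweedler (\<lambda>a b. sweedler (\<lambda>c d. G a b c d) y) x = sweedler (\<lambda>c d. sweedler (\<lambda>a b. G a b c d) x) y"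
proof -
  have "(\<Sum>p\<leftarrow>ps. \<Sum>q\<leftarrow>qs. g p q) = (\<Sum>q\<leftarrow>qs. \<Sum>p\<leftarrow>ps. g p q)"
    for g :: "'h \<times> 'h \<Rightarrow> 'h \<times> 'h \<Rightarrow> 'u" and ps qs
    by (induction ps) (auto simp: sum_list_addf)
  then show ?thesis by (simp add: sweedler_def case_prod_unfold)
qed

text \<open>A trilinear \<open>T\<close> induces a linear map on \<open>\<H> \<otimes> (\<H> \<otimes> \<H>)\<close>; the two sides are its values at
the two sides of the coassociativity axiom.\<close>

lemma sweedler_coassoc:
  fixes T :: "'h \<Rightarrow> 'h \<Rightarrow> 'h \<Rightarrow> 'u::ab_group_add"
  assumes sU: "vector_space sU"
    and T: "\<And>a. hbilinear sU (T a)" "\<And>b c. hlinear sU (\<lambda>a. T a b c)"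
  shows "sweedler (\<lambda>a b. sweedler (\<lambda>c d. T c d b) a) x = sweedler (\<lambda>a b. sweedler (\<lambda>c d. T a c d) b) x"
proof -
  interpret sU: vector_space sU by fact
  let ?HH = "tensor_space (hscale H) (hscale H) UNIV UNIV"
  have hl: "bilinear_map_on (hscale H) (hscale H) sU UNIV UNIV (T a)" for a
    by (rule bilinear_map_onI[OF sU T(1)])
  have sumT: "hlift H (T a) (\<Sum>(b, c)\<leftarrow>ps. tensor (hscale H) (hscale H) b c) = (\<Sum>(b, c)\<leftarrow>ps. T a b c)"
    for a ps
    unfolding hlift_def by (rule bilinear_map_on.lift_presentation[OF hl]) simp
  have in_HH: "htensor H a b \<in> ?HH" for a b
    using tensor_presentation_in_space[of "[(a, b)]" UNIV UNIV "hscale H" "hscale H"]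
    by (simp add: htensor_def)
  interpret L: bilinear_map_on "hscale H" fscale sU UNIV ?HH "\<lambda>a. hlift H (T a)"
  proof
    show "bilinear_on (hscale H) fscale sU UNIV ?HH (\<lambda>a. hlift H (T a))"
      unfolding bilinear_on_def
    proof (intro conjI ballI allI)
      fix a a' c and t assume t: "t \<in> ?HH"
      then obtain ps where ps: "t = (\<Sum>(b, c)\<leftarrow>ps. tensor (hscale H) (hscale H) b c)"
        using bilinear_map_on.presentation[OF hl] by metis
      show "hlift H (T (a + a')) t = hlift H (T a) t + hlift H (T a') t"
        unfolding ps sumT using T(2) by (simp add: hlinear_def sum_list_addf case_prod_unfold)
      show "hlift H (T (hscale H c a)) t = sU c (hlift H (T a) t)"
        unfolding ps sumT using T(2)
        by (simp add: hlinear_def additive_sum_list[of "sU c", OF sU.scale_right_distrib] case_prod_unfold)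
      show "hlift H (T a) (fscale c t) = sU c (hlift H (T a) t)"
        unfolding hlift_def by (rule bilinear_map_on.lift_scale[OF hl t])
      fix t' assume t': "t' \<in> ?HH"
      show "hlift H (T a) (t + t') = hlift H (T a) t + hlift H (T a) t'"
        unfolding hlift_def by (rule bilinear_map_on.lift_add[OF hl t t'])
    qed
  qed (auto simp: tensor_space_def vector_space_hscale vector_space_fscale sU)
  let ?t = "tensor (hscale H) (fscale :: 'k \<Rightarrow> ('k, 'h, 'h) tensor \<Rightarrow> _)"
  let ?L = "tensor_lift (hscale H) fscale UNIV ?HH (\<lambda>a. hlift H (T a))"
  have mem: "?t a (htensor H b c) \<in> tensor_space (hscale H) fscale UNIV ?HH" for a b c
    using tensor_presentation_in_space[of "[(a, htensor H b c)]" UNIV ?HH "hscale H" fscale] in_HH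
    by simp
  have val: "?L (?t a (htensor H b c)) = T a b c" for a b c
    using L.lift_tensor[OF _ in_HH] bilinear_map_on.lift_tensor[OF hl]
    by (simp add: hlift_def htensor_def)
  have lift_sweedler: "?L (sweedler G y) = sweedler (\<lambda>a b. ?L (G a b)) y
      \<and> sweedler G y \<in> tensor_space (hscale H) fscale UNIV ?HH"
    if "\<And>a b. G a b \<in> tensor_space (hscale H) fscale UNIV ?HH" for G y
    using L.lift_sum_list[of "coproduct_pairs y" "\<lambda>(a, b). G a b"] that
    by (simp add: sweedler_def case_prod_unfold)
  have "sweedler (\<lambda>a b. sweedler (\<lambda>c d. ?t c (htensor H d b)) a) x
    = hlift H (\<lambda>a b. hlift H (\<lambda>c d. ?t c (htensor H d b)) (comult H a)) (comult H x)"
  proof -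
    have 1: "hbilinear fscale (\<lambda>c d. ?t c (htensor H d b))" for b
      by (auto simp: hbilinear_def hlinear_def htensor_def tensor_add_left tensor_add_right
          tensor_scale tensor_scale_right)
    have "hbilinear fscale (\<lambda>a b. sweedler (\<lambda>c d. ?t c (htensor H d b)) a)"
      unfolding hbilinear_def
      by (auto simp: hlinear_def sweedler_add_arg[OF vector_space_fscale 1[unfolded htensor_def]]
          sweedler_scale_arg[OF vector_space_fscale 1[unfolded htensor_def]] sweedler_add[symmetric]
          sweedler_scale[OF vector_space_fscale, symmetric] htensor_def tensor_add_right
          tensor_scale_right)
    then show ?thesis by (simp add: hlift_comult[OF vector_space_fscale] 1)
  qed
  also have "\<dots> = hlift H (\<lambda>a b. ?t a (comult H b)) (comult H x)" by (rule coassoc)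
  also have "\<dots> = sweedler (\<lambda>a b. ?t a (comult H b)) x"
  proof (rule hlift_comult[OF vector_space_fscale])
    have "comult H (x + y) = comult H x + comult H y" "comult H (hscale H c x) = fscale c (comult H x)"
      for x y c
      using comult_linear by (simp_all add: hlinear_iff vector_space_fscale hlinear_def)
    then show "hbilinear fscale (\<lambda>a b. ?t a (comult H b))"
      by (auto simp: hbilinear_def hlinear_def tensor_add_left tensor_add_right
          tensor_scale tensor_scale_right)
  qed
  also have "\<dots> = sweedler (\<lambda>a b. sweedler (\<lambda>c d. ?t a (htensor H c d)) b) x"
    by (simp only: comult_sweedler additive_sweedler[of "?t _", OF tensor_add_right])
  finally have "?L (sweedler (\<lambda>a b. sweedler (\<lambda>c d. ?t c (htensor H d b)) a) x)
    = ?L (sweedler (\<lambda>a b. sweedler (\<lambda>c d. ?t a (htensor H c d)) b) x)" by simp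
  then show ?thesis by (simp add: lift_sweedler mem val)
qed

lemma sweedler_mult:
  fixes F :: "'h \<Rightarrow> 'h \<Rightarrow> 'u::ab_group_add"
  assumes sU: "vector_space sU" and F: "hbilinear sU F"
  shows "sweedler F (x * y) = sweedler (\<lambda>a b. sweedler (\<lambda>c d. F (a * c) (b * d)) y) x"
proof -
  interpret L: bilinear_map_on "hscale H" "hscale H" sU UNIV UNIV F by (rule bilinear_map_onI[OF sU F])
  let ?HH = "tensor_space (hscale H) (hscale H) UNIV UNIV"
  have mem: "htensor H a b \<in> ?HH" for a b
    using tensor_presentation_in_space[of "[(a, b)]" UNIV UNIV "hscale H" "hscale H"]
    by (simp add: htensor_def)
  have lift_sweedler: "hlift H F (sweedler G y) = sweedler (\<lambda>a b. hlift H F (G a b)) y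
      \<and> sweedler G y \<in> ?HH"
    if "\<And>a b. G a b \<in> ?HH" for G y
    using L.lift_sum_list[of "coproduct_pairs y" "\<lambda>(a, b). G a b"] that
    by (simp add: sweedler_def hlift_def case_prod_unfold)
  have 1: "hbilinear fscale (\<lambda>c d. htensor H (a * c) (b * d))" for a b
    by (auto simp: hbilinear_def hlinear_def htensor_def tensor_add_left tensor_add_right
        tensor_scale tensor_scale_right distrib_left hscale_mult_right[symmetric])
  have "hbilinear fscale (\<lambda>a b. sweedler (\<lambda>c d. htensor H (a * c) (b * d)) y)"
    unfolding hbilinear_def
    by (auto simp: hlinear_def sweedler_add[symmetric]
        sweedler_scale[OF vector_space_fscale, symmetric] htensor_def tensor_add_right tensor_add_left
        tensor_scale_right tensor_scale distrib_right hscale_mult_left[symmetric])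
  then have "comult H (x * y) = sweedler (\<lambda>a b. sweedler (\<lambda>c d. htensor H (a * c) (b * d)) y) x"
    by (simp add: comult_mult hlift_comult[OF vector_space_fscale] 1)
  then have "hlift H F (comult H (x * y))
    = hlift H F (sweedler (\<lambda>a b. sweedler (\<lambda>c d. htensor H (a * c) (b * d)) y) x)" by simp
  also have "\<dots> = sweedler (\<lambda>a b. sweedler (\<lambda>c d. F (a * c) (b * d)) y) x"
    using L.lift_tensor by (simp add: lift_sweedler mem) (simp add: hlift_def htensor_def)
  finally show ?thesis by (simp only: hlift_comult[OF sU F])
qed

lemma counit_hlinear: "hlinear (*) (counit H)"
  using counit_linear by (simp add: hlinear_iff vector_space_field)

lemma antipode_hlinear: "hlinear (hscale H) (antipode H)"
  using antipode_linear by (simp add: hlinear_iff vector_space_hscale)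

lemmas hlinear_simps = counit_hlinear[unfolded hlinear_def] antipode_hlinear[unfolded hlinear_def]

lemma sweedler_counit_left:
  assumes sU: "vector_space sU" and f: "hlinear sU f"
  shows "sweedler (\<lambda>a b. sU (counit H a) (f b)) x = f x"
proof -
  have "hbilinear (hscale H) (\<lambda>a b. hscale H (counit H a) b)"
    by (simp add: hbilinear_def hlinear_def hlinear_simps hs.scale_right_distrib
        hs.scale_left_distrib mult.commute)
  then have "sweedler (\<lambda>a b. hscale H (counit H a) b) x = x"
    using counit_left by (simp add: hlift_comult[OF vector_space_hscale])
  then have "f x = f (sweedler (\<lambda>a b. hscale H (counit H a) b) x)" by simp
  also have "\<dots> = sweedler (\<lambda>a b. sU (counit H a) (f b)) x"
    using f by (simp add: additive_sweedler hlinear_def)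
  finally show ?thesis ..
qed

lemma sweedler_counit_right:
  assumes sU: "vector_space sU" and f: "hlinear sU f"
  shows "sweedler (\<lambda>a b. sU (counit H b) (f a)) x = f x"
proof -
  have "hbilinear (hscale H) (\<lambda>a b. hscale H (counit H b) a)"
    by (simp add: hbilinear_def hlinear_def hlinear_simps hs.scale_right_distrib
        hs.scale_left_distrib mult.commute)
  then have "sweedler (\<lambda>a b. hscale H (counit H b) a) x = x"
    using counit_right by (simp add: hlift_comult[OF vector_space_hscale])
  then have "f x = f (sweedler (\<lambda>a b. hscale H (counit H b) a) x)" by simp
  also have "\<dots> = sweedler (\<lambda>a b. sU (counit H b) (f a)) x"
    using f by (simp add: additive_sweedler hlinear_def)
  finally show ?thesis ..
qed

lemma sweedler_mult_left: "u * sweedler F x = sweedler (\<lambda>a b. u * F a b) x"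
  for u :: "'u::ring"
  by (rule additive_sweedler) (rule distrib_left)

lemma sweedler_mult_right: "sweedler F x * u = sweedler (\<lambda>a b. F a b * u) x"
  for u :: "'u::ring"
  by (rule additive_sweedler[of "\<lambda>v. v * u"]) (rule distrib_right)

text \<open>The outer factors \<open>u\<close> and \<open>v\<close> allow the antipode axiom to be applied in the middle of a
longer product.\<close>

lemma sweedler_antipode_left:
  "sweedler (\<lambda>a b. u * antipode H a * b * v) x = hscale H (counit H x) (u * v)"
proof -
  have "hbilinear (hscale H) (\<lambda>a b. antipode H a * b)"
    by (simp add: hbilinear_def hlinear_def hlinear_simps distrib_left distrib_right
        hscale_mult_left[symmetric] hscale_mult_right[symmetric])
  then have "sweedler (\<lambda>a b. antipode H a * b) x = hscale H (counit H x) 1"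
    using antipode_left by (simp add: hlift_comult[OF vector_space_hscale])
  then have "u * sweedler (\<lambda>a b. antipode H a * b) x * v = u * hscale H (counit H x) 1 * v" by simp
  then show ?thesis
    by (simp add: sweedler_mult_left sweedler_mult_right mult.assoc
        hscale_mult_left[symmetric] hscale_mult_right[symmetric])
qed

lemma sweedler_antipode_right:
  "sweedler (\<lambda>a b. u * a * antipode H b * v) x = hscale H (counit H x) (u * v)"
proof -
  have "hbilinear (hscale H) (\<lambda>a b. a * antipode H b)"
    by (simp add: hbilinear_def hlinear_def hlinear_simps distrib_left distrib_right
        hscale_mult_left[symmetric] hscale_mult_right[symmetric])
  then have "sweedler (\<lambda>a b. a * antipode H b) x = hscale H (counit H x) 1"
    using antipode_right by (simp add: hlift_comult[OF vector_space_hscale])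
  then have "u * sweedler (\<lambda>a b. a * antipode H b) x * v = u * hscale H (counit H x) 1 * v" by simp
  then show ?thesis
    by (simp add: sweedler_mult_left sweedler_mult_right mult.assoc
        hscale_mult_left[symmetric] hscale_mult_right[symmetric])
qed

text \<open>Among bilinear maps \<open>\<H> \<times> \<H> \<rightarrow> \<H>\<close> under convolution, \<open>(x, y) \<mapsto> S (x * y)\<close> is a left inverse
and \<open>(x, y) \<mapsto> S y * S x\<close> a right inverse of the multiplication, so they are equal. Concretely,
both are found by evaluating \<open>\<Sum> S (x\<^sub>1 y\<^sub>1) x\<^sub>2 y\<^sub>2 S y\<^sub>3 S x\<^sub>3\<close>, grouping the
indices \<open>2, 3\<close> or the indices \<open>1, 2\<close>.\<close>

lemma antipode_mult: "antipode H (x * y) = antipode H y * antipode H x"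
proof -
  let ?S = "antipode H" and ?e = "counit H"
  let ?T = "\<lambda>a p q c r s. ?S (a * c) * p * r * ?S s * ?S q"
  note simps = hlinear_simps distrib_left distrib_right hscale_mult_left[symmetric]
    hscale_mult_right[symmetric] sweedler_add sweedler_scale[OF vector_space_hscale]
  have expand: "sweedler (\<lambda>a b. sweedler (\<lambda>c d. sweedler (\<lambda>p q. sweedler (\<lambda>r s. ?T a p q c r s) d) b) y) x
    = ?S (x * y)"
  proof -
    have "sweedler (\<lambda>p q. sweedler (\<lambda>r s. ?T a p q c r s) d) b
      = hscale H (?e d) (hscale H (?e b) (?S (a * c)))" for a b c d
      using sweedler_antipode_right[of "?S (a * c)" 1 b]
      by (simp add: sweedler_antipode_right sweedler_scale[OF vector_space_hscale])
    moreover have "sweedler (\<lambda>c d. hscale H (?e d) (hscale H (?e b) (?S (a * c)))) y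
      = hscale H (?e b) (?S (a * y))" for a b
      by (rule sweedler_counit_right[OF vector_space_hscale])
        (simp add: hlinear_def simps hs.scale_right_distrib mult.commute)
    moreover have "sweedler (\<lambda>a b. hscale H (?e b) (?S (a * y))) x = ?S (x * y)"
      by (rule sweedler_counit_right[OF vector_space_hscale]) (simp add: hlinear_def simps)
    ultimately show ?thesis by simp
  qed
  have regroup: "sweedler (\<lambda>c d. sweedler (\<lambda>r s. ?T a p q c r s) d) y
    = sweedler (\<lambda>c d. sweedler (\<lambda>r s. ?T a p q r s d) c) y" for a p q
    by (rule sweedler_coassoc[OF vector_space_hscale, symmetric])
      (simp_all add: hbilinear_def hlinear_def simps)
  have "sweedler (\<lambda>a b. sweedler (\<lambda>c d. sweedler (\<lambda>p q. sweedler (\<lambda>r s. ?T a p q c r s) d) b) y) x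
    = sweedler (\<lambda>a b. sweedler (\<lambda>p q. sweedler (\<lambda>c d. sweedler (\<lambda>r s. ?T a p q r s d) c) y) b) x"
    by (subst sweedler_swap) (simp only: regroup)
  also have "\<dots> = sweedler (\<lambda>a b. sweedler (\<lambda>p q. sweedler (\<lambda>c d. sweedler (\<lambda>r s. ?T p q b r s d) c) y) a) x"
    by (rule sweedler_coassoc[OF vector_space_hscale, symmetric])
      (simp_all add: hbilinear_def hlinear_def simps)
  also have "\<dots> = sweedler (\<lambda>a b. sweedler (\<lambda>c d. sweedler (\<lambda>p q. sweedler (\<lambda>r s. ?T p q b r s d) c) a) y) x"
    by (subst sweedler_swap) (rule refl)
  also have "\<dots> = ?S y * ?S x"
  proof -
    have "sweedler (\<lambda>p q. sweedler (\<lambda>r s. ?T p q b r s d) c) a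
      = hscale H (?e a) (hscale H (?e c) (?S d * ?S b))" for a b c d
    proof -
      \<comment> \<open>The inner sums form a sum over the coproduct of the product \<open>a * c\<close>.\<close>
      have "hbilinear (hscale H) (\<lambda>u v. ?S u * v * (?S d * ?S b))"
        by (simp add: hbilinear_def hlinear_def simps)
      from sweedler_mult[OF vector_space_hscale this, of a c]
      show ?thesis
        using sweedler_antipode_left[of 1 "?S d * ?S b" "a * c"]
        by (simp add: mult.assoc counit_mult)
    qed
    moreover have "sweedler (\<lambda>c d. hscale H (?e a) (hscale H (?e c) (?S d * ?S b))) y
      = hscale H (?e a) (?S y * ?S b)" for a b
      using sweedler_counit_left[OF vector_space_hscale, of "\<lambda>d. ?S d * ?S b" y]
      by (simp add: sweedler_scale[OF vector_space_hscale] hlinear_def simps del: hs.scale_scale)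
    moreover have "sweedler (\<lambda>a b. hscale H (?e a) (?S y * ?S b)) x = ?S y * ?S x"
      by (rule sweedler_counit_left[OF vector_space_hscale]) (simp add: hlinear_def simps)
    ultimately show ?thesis by simp
  qed
  finally show ?thesis using expand by simp
qed

section \<open>The convolution algebra of functionals\<close>

abbreviation functional :: "('h \<Rightarrow> 'k) \<Rightarrow> bool" where
  "functional \<equiv> hlinear (*)"

lemma functional_subspace: "fun_vs.subspace {f. functional f}"
  by (auto simp: fun_vs.subspace_def hlinear_def fscale_apply algebra_simps)

lemma hbilinear_product: "functional f \<Longrightarrow> functional g \<Longrightarrow> hbilinear (*) (\<lambda>a b. f a * g b)"
  by (auto simp: hbilinear_def hlinear_def algebra_simps)

lemma dual_mult_sweedler:
  "functional f \<Longrightarrow> functional g \<Longrightarrow> dual_mult H f g x = sweedler (\<lambda>a b. f a * g b) x"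
  by (simp add: dual_mult_def hlift_comult[OF vector_space_field hbilinear_product])

lemma functional_dual_mult: "functional f \<Longrightarrow> functional g \<Longrightarrow> functional (dual_mult H f g)"
  by (simp add: hlinear_def[of _ "dual_mult H f g"] dual_mult_sweedler
      sweedler_add_arg[OF vector_space_field hbilinear_product]
      sweedler_scale_arg[OF vector_space_field hbilinear_product])

lemma dual_mult_assoc:
  assumes "functional f" "functional g" "functional h"
  shows "dual_mult H (dual_mult H f g) h = dual_mult H f (dual_mult H g h)"
proof
  fix x
  have "sweedler (\<lambda>a b. sweedler (\<lambda>c d. f c * g d * h b) a) x
    = sweedler (\<lambda>a b. sweedler (\<lambda>c d. f a * g c * h d) b) x"
    by (rule sweedler_coassoc[OF vector_space_field])
      (use assms in \<open>auto simp: hbilinear_def hlinear_def algebra_simps\<close>)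
  then show "dual_mult H (dual_mult H f g) h x = dual_mult H f (dual_mult H g h) x"
    using assms
    by (simp add: dual_mult_sweedler functional_dual_mult sweedler_mult_left sweedler_mult_right mult.assoc)
qed

lemma dual_mult_one_left: "functional f \<Longrightarrow> dual_mult H (dual_one H) f = f"
  using sweedler_counit_left[OF vector_space_field]
  by (auto simp: fun_eq_iff dual_one_def dual_mult_sweedler counit_hlinear)

lemma functional_add: "functional f \<Longrightarrow> functional g \<Longrightarrow> functional (f + g)"
  using fun_vs.subspace_add[OF functional_subspace] by auto

lemma functional_scale: "functional f \<Longrightarrow> functional (fscale c f)"
  using fun_vs.subspace_scale[OF functional_subspace] by auto

lemma functional_sum: "(\<And>i. i \<in> A \<Longrightarrow> functional (f i)) \<Longrightarrow> functional (\<Sum>i\<in>A. f i)"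
  using fun_vs.subspace_sum[OF functional_subspace, of A f] by auto

lemma dual_mult_add_left:
  "functional f \<Longrightarrow> functional g \<Longrightarrow> functional h \<Longrightarrow>
    dual_mult H (f + g) h = dual_mult H f h + dual_mult H g h"
  by (auto simp: fun_eq_iff dual_mult_sweedler functional_add distrib_right sweedler_add)

lemma dual_mult_add_right:
  "functional f \<Longrightarrow> functional g \<Longrightarrow> functional h \<Longrightarrow>
    dual_mult H f (g + h) = dual_mult H f g + dual_mult H f h"
  by (auto simp: fun_eq_iff dual_mult_sweedler functional_add distrib_left sweedler_add)

lemma dual_mult_scale_left:
  "functional f \<Longrightarrow> functional g \<Longrightarrow> dual_mult H (fscale c f) g = fscale c (dual_mult H f g)"
  by (auto simp: fun_eq_iff dual_mult_sweedler functional_scale fscale_apply sweedler_mult_left mult.assoc)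

lemma dual_mult_scale_right:
  "functional f \<Longrightarrow> functional g \<Longrightarrow> dual_mult H f (fscale c g) = fscale c (dual_mult H f g)"
  by (auto simp: fun_eq_iff dual_mult_sweedler functional_scale fscale_apply sweedler_mult_left mult_ac)

lemma functional_zero: "functional 0"
  by (simp add: hlinear_def)

lemma dual_mult_zero_left: "functional h \<Longrightarrow> dual_mult H 0 h = 0"
  using dual_mult_add_left[of 0 0 h] functional_zero by simp

lemma dual_mult_zero_right: "functional h \<Longrightarrow> dual_mult H h 0 = 0"
  using dual_mult_add_right[of h 0 0] functional_zero by simp

lemma dual_mult_sum_left:
  assumes "\<And>i. i \<in> A \<Longrightarrow> functional (f i)" "functional h"
  shows "dual_mult H (\<Sum>i\<in>A. f i) h = (\<Sum>i\<in>A. dual_mult H (f i) h)"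
  using assms
  by (induction A rule: infinite_finite_induct)
    (auto simp: dual_mult_zero_left dual_mult_add_left functional_sum)

lemma dual_mult_sum_right:
  assumes "\<And>i. i \<in> A \<Longrightarrow> functional (f i)" "functional h"
  shows "dual_mult H h (\<Sum>i\<in>A. f i) = (\<Sum>i\<in>A. dual_mult H h (f i))"
  using assms
  by (induction A rule: infinite_finite_induct)
    (auto simp: dual_mult_zero_right dual_mult_add_right functional_sum)

section \<open>The finite dual\<close>

lemma finite_dual_functional: "f \<in> finite_dual H \<Longrightarrow> functional f"
  by (simp add: finite_dual_def hlinear_iff vector_space_field)

text \<open>Each further functional cuts the common kernel down by at most one dimension, which is
made up by one vector \<open>z\<close> of the previous common kernel.\<close>

lemma common_kernel_cofinite:
  assumes "\<And>c. c \<in> set cs \<Longrightarrow> functional c"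
  shows "\<exists>B. finite B \<and> (\<forall>x. \<exists>b\<in>hs.span B. \<forall>c\<in>set cs. c (x - b) = 0)"
  using assms
proof (induction cs)
  case Nil
  show ?case by (intro exI[of _ "{}"]) auto
next
  case (Cons c cs)
  then obtain B where B: "finite B" "\<And>x. \<exists>b\<in>hs.span B. \<forall>c\<in>set cs. c (x - b) = 0" by auto
  show ?case
  proof (cases "\<exists>z. (\<forall>c\<in>set cs. c z = 0) \<and> c z \<noteq> 0")
    case True
    then obtain z where z: "\<forall>c\<in>set cs. c z = 0" "c z \<noteq> 0" by blast
    have "\<exists>b\<in>hs.span (insert z B). \<forall>d\<in>set (c # cs). d (x - b) = 0" for x
    proof -
      obtain b where b: "b \<in> hs.span B" "\<forall>c\<in>set cs. c (x - b) = 0" using B(2) by blast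
      let ?l = "c (x - b) / c z"
      have d: "d (x - (b + hscale H ?l z)) = d (x - b) - ?l * d z" if "d \<in> set (c # cs)" for d
      proof -
        have "d ((x - (b + hscale H ?l z)) + hscale H ?l z) = d (x - (b + hscale H ?l z)) + ?l * d z"
          using Cons.prems[OF that] unfolding hlinear_def by metis
        then show ?thesis by (simp add: algebra_simps)
      qed
      have "b + hscale H ?l z \<in> hs.span (insert z B)"
        using b(1) hs.span_mono[of B "insert z B"]
        by (intro hs.span_add hs.span_scale) (auto intro: hs.span_base)
      moreover have "\<forall>e\<in>set (c # cs). e (x - (b + hscale H ?l z)) = 0"
      proof
        fix e assume e: "e \<in> set (c # cs)"
        show "e (x - (b + hscale H ?l z)) = 0"
          unfolding d[OF e] using e z b(2) by auto
      qed
      ultimately show ?thesis by blast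
    qed
    then show ?thesis using B(1) by (intro exI[of _ "insert z B"]) auto
  next
    case False
    then show ?thesis using B by (intro exI[of _ B]) (metis set_ConsD)
  qed
qed

lemma functional_diff: "functional f \<Longrightarrow> f (x - y) = f x - f y"
  unfolding hlinear_def by (metis add_diff_cancel_right' diff_add_cancel)

lemma functional_translates:
  assumes "functional f"
  shows "functional (\<lambda>x. f (x * h))" "functional (\<lambda>x. f (h * x))"
  using assms
  by (auto simp: hlinear_def distrib_left distrib_right hscale_mult_left[symmetric]
      hscale_mult_right[symmetric])

lemma functional_span:
  assumes "\<And>g. g \<in> G \<Longrightarrow> functional g" "f \<in> fun_vs.span G"
  shows "functional f"
  using fun_vs.span_minimal[OF _ functional_subspace, of G] assms by auto

text \<open>If \<open>f\<close> vanishes on a cofinite ideal, expanding \<open>y\<close> modulo the ideal in a finite set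
separates the variables in \<open>f (x * y)\<close>. Conversely, the largest ideal in the kernel of \<open>f\<close>
consists of all \<open>z\<close> with \<open>f (x * z * y) = 0\<close> for all \<open>x\<close> and \<open>y\<close>. Separating the variables
twice, with the intermediate factors chosen as translates of \<open>f\<close>, shows that it contains the
common kernel of finitely many functionals.\<close>

theorem finite_dual_iff:
  "f \<in> finite_dual H \<longleftrightarrow> functional f \<and> (\<exists>ps. \<forall>x y. f (x * y) = (\<Sum>(a, b)\<leftarrow>ps. a x * b y))"
    (is "?L \<longleftrightarrow> ?R")
proof
  assume f: ?L
  then obtain I B where I: "two_sided_ideal I" "\<And>x. x \<in> I \<Longrightarrow> f x = 0"
    and B: "finite B" "\<And>x. \<exists>b\<in>hs.span B. x - b \<in> I"
    by (auto simp: finite_dual_def cofinite_ideal_def)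
  have lin: "functional f" using f by (rule finite_dual_functional)
  have "\<exists>u. x - (\<Sum>v\<in>B. hscale H (u v) v) \<in> I" for x
    using B(2)[of x] by (auto simp: hs.span_finite[OF B(1)])
  then obtain u where u: "\<And>x. x - (\<Sum>v\<in>B. hscale H (u x v) v) \<in> I" by metis
  obtain vs where vs: "set vs = B" "distinct vs" using B(1) finite_distinct_list by blast
  have "f (x * y) = (\<Sum>(a, b)\<leftarrow>map (\<lambda>v. (\<lambda>x. f (x * v), \<lambda>y. u y v)) vs. a x * b y)" for x y
  proof -
    interpret fx: Vector_Spaces.linear "hscale H" "(*)" "\<lambda>y. f (x * y)"
      using functional_translates(2)[OF lin] by (simp add: hlinear_iff vector_space_field)
    have "x * (y - (\<Sum>v\<in>B. hscale H (u y v) v)) \<in> I"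
      using I(1) u by (auto simp: two_sided_ideal_def)
    then have "f (x * (y - (\<Sum>v\<in>B. hscale H (u y v) v))) = 0" by (rule I(2))
    then have "f (x * y) = f (x * (\<Sum>v\<in>B. hscale H (u y v) v))"
      by (simp only: fx.diff right_minus_eq)
    also have "\<dots> = (\<Sum>v\<in>B. u y v * f (x * v))"
      using fx.sum[of "\<lambda>v. hscale H (u y v) v" B] fx.scale by simp
    finally show ?thesis
      by (simp add: vs(1)[symmetric] sum.distinct_set_conv_list[OF vs(2)] o_def mult.commute)
  qed
  then show ?R using lin by blast
next
  assume ?R
  then obtain ps where lin: "functional f" and ps: "\<And>x y. f (x * y) = (\<Sum>(a, b)\<leftarrow>ps. a x * b y)" by blast
  obtain qs where qs: "set qs \<subseteq> range (\<lambda>y x. f (x * y)) \<times> fun_vs.span (range (\<lambda>x y. f (x * y)))"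
      "\<And>x y. f (x * y) = (\<Sum>(a, b)\<leftarrow>qs. a x * b y)"
    using skeleton_decomposition[of "\<lambda>x y. f (x * y)" ps] ps by auto
  have "\<exists>cs. (\<forall>c\<in>set cs. functional c) \<and> (\<forall>z. (\<forall>c\<in>set cs. c z = 0) \<longrightarrow> (\<forall>x. a (x * z) = 0))"
    if a_qs: "a \<in> set (map fst qs)" for a
  proof -
    obtain b where "(a, b) \<in> set qs" using a_qs by auto
    then obtain y where a: "a = (\<lambda>x. f (x * y))" using qs(1) by blast
    have "a (x * z) = (\<Sum>(a', b')\<leftarrow>map (\<lambda>(a', b'). (a', \<lambda>z. b' (z * y))) qs. a' x * b' z)" for x z
    proof -
      have "a (x * z) = f (x * (z * y))" by (simp add: a mult.assoc)
      then show ?thesis by (simp add: qs(2) case_prod_unfold o_def)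
    qed
    then obtain rs where
      rs: "set rs \<subseteq> range (\<lambda>z x. a (x * z)) \<times> fun_vs.span (range (\<lambda>x z. a (x * z)))"
        "\<And>x z. a (x * z) = (\<Sum>(a', b')\<leftarrow>rs. a' x * b' z)"
      using skeleton_decomposition[of "\<lambda>x z. a (x * z)"] by metis
    have "functional a" unfolding a by (rule functional_translates(1)[OF lin])
    then have "functional c" if "c \<in> set (map snd rs)" for c
      using that rs(1) functional_translates(2)
      by (intro functional_span[of "range (\<lambda>x z. a (x * z))" c]) auto
    moreover have "a (x * z) = 0" if z: "\<forall>c\<in>set (map snd rs). c z = 0" for x z
    proof -
      have "(\<Sum>(a', b')\<leftarrow>rs. a' x * b' z) = (\<Sum>p\<leftarrow>rs. 0)"
        by (rule sum_list_cong) (use z in \<open>auto simp: case_prod_unfold\<close>)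
      then show ?thesis by (simp add: rs(2))
    qed
    ultimately show ?thesis by blast
  qed
  then obtain cs where cs: "\<And>a c. a \<in> set (map fst qs) \<Longrightarrow> c \<in> set (cs a) \<Longrightarrow> functional c"
      "\<And>a z x. a \<in> set (map fst qs) \<Longrightarrow> \<forall>c\<in>set (cs a). c z = 0 \<Longrightarrow> a (x * z) = 0"
    by metis
  define ds where "ds = concat (map cs (map fst qs))"
  define I where "I = {z. \<forall>x y. f (x * z * y) = 0}"
  have ker: "z \<in> I" if "\<forall>c\<in>set ds. c z = 0" for z
  proof -
    have "f (x * z * y) = 0" for x y
    proof -
      have "f (x * z * y) = (\<Sum>p\<leftarrow>qs. 0)"
        unfolding qs(2)
      proof (rule sum_list_cong)
        fix p assume p: "p \<in> set qs"
        then have "fst p (x * z) = 0" using that by (intro cs(2)) (auto simp: ds_def)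
        then show "(case p of (a, b) \<Rightarrow> a (x * z) * b y) = 0" by (simp add: case_prod_unfold)
      qed
      then show ?thesis by simp
    qed
    then show ?thesis by (simp add: I_def)
  qed
  have "two_sided_ideal I"
    unfolding two_sided_ideal_def
  proof (intro conjI ballI allI)
    show "0 \<in> I" using lin functional_diff[of f 0 0] by (simp add: I_def)
    fix x assume x: "x \<in> I"
    show "r * x \<in> I" for r using x by (simp add: I_def mult.assoc[symmetric])
    show "x * r \<in> I" for r using x by (simp add: I_def mult.assoc)
    show "x - y \<in> I" if "y \<in> I" for y
      using x that by (simp add: I_def left_diff_distrib right_diff_distrib functional_diff[OF lin])
  qed
  moreover have "\<exists>B. finite B \<and> (\<forall>x. \<exists>b\<in>hs.span B. x - b \<in> I)"
  proof -
    have "functional c" if "c \<in> set ds" for c using that cs(1) by (auto simp: ds_def)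
    from common_kernel_cofinite[OF this] obtain B
      where B: "finite B" "\<And>x. \<exists>b\<in>hs.span B. \<forall>c\<in>set ds. c (x - b) = 0" by blast
    then have "\<exists>b\<in>hs.span B. x - b \<in> I" for x using ker by blast
    then show ?thesis using B(1) by blast
  qed
  moreover have "\<forall>z\<in>I. f z = 0"
  proof
    fix z assume "z \<in> I"
    then have "f (1 * z * 1) = 0" unfolding I_def by blast
    then show "f z = 0" by simp
  qed
  ultimately show ?L
    using lin by (auto simp: finite_dual_def cofinite_ideal_def hlinear_iff vector_space_field)
qed

lemma finite_dualI:
  "functional f \<Longrightarrow> (\<And>x y. f (x * y) = (\<Sum>(a, b)\<leftarrow>ps. a x * b y)) \<Longrightarrow> f \<in> finite_dual H"
  by (auto simp: finite_dual_iff)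

lemma finite_dual_translates:
  assumes "f \<in> finite_dual H"
  shows "(\<lambda>x. f (x * h)) \<in> finite_dual H" "(\<lambda>x. f (h * x)) \<in> finite_dual H"
proof -
  obtain ps where ps: "\<And>x y. f (x * y) = (\<Sum>(a, b)\<leftarrow>ps. a x * b y)" and f: "functional f"
    using assms by (auto simp: finite_dual_iff)
  have "f (x * y * h) = (\<Sum>(a, b)\<leftarrow>map (\<lambda>(a, b). (a, \<lambda>y. b (y * h))) ps. a x * b y)" for x y
    by (simp add: ps mult.assoc case_prod_unfold o_def)
  moreover have "f (h * (x * y)) = (\<Sum>(a, b)\<leftarrow>map (\<lambda>(a, b). (\<lambda>x. a (h * x), b)) ps. a x * b y)" for x y
    by (simp add: ps mult.assoc[symmetric] case_prod_unfold o_def)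
  ultimately show "(\<lambda>x. f (x * h)) \<in> finite_dual H" "(\<lambda>x. f (h * x)) \<in> finite_dual H"
    using functional_translates[OF f] by (blast intro: finite_dualI)+
qed

lemma finite_dual_subspace: "fun_vs.subspace (finite_dual H)"
  unfolding fun_vs.subspace_def
proof (intro conjI ballI allI)
  show "0 \<in> finite_dual H"
    by (rule finite_dualI[of _ "[]"]) (simp_all add: functional_zero)
  fix f assume "f \<in> finite_dual H"
  then obtain ps where ps: "\<And>x y. f (x * y) = (\<Sum>(a, b)\<leftarrow>ps. a x * b y)" and f: "functional f"
    by (auto simp: finite_dual_iff)
  show "fscale c f \<in> finite_dual H" for c
    using functional_scale[OF f]
    by (rule finite_dualI[where ps = "map (\<lambda>(a, b). (\<lambda>x. c * a x, b)) ps"])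
      (simp add: fscale_apply ps sum_list_const_mult[symmetric] case_prod_unfold o_def mult.assoc)
  fix g assume "g \<in> finite_dual H"
  then obtain qs where qs: "\<And>x y. g (x * y) = (\<Sum>(a, b)\<leftarrow>qs. a x * b y)" and g: "functional g"
    by (auto simp: finite_dual_iff)
  show "f + g \<in> finite_dual H"
    using functional_add[OF f g] by (rule finite_dualI[where ps = "ps @ qs"]) (simp add: ps qs)
qed

lemma translate_pairs:
  assumes f: "f \<in> finite_dual H"
  obtains ps where "set ps \<subseteq> range (\<lambda>y x. f (x * y)) \<times> fun_vs.span (range (\<lambda>x y. f (x * y)))"
    and "set ps \<subseteq> finite_dual H \<times> finite_dual H"
    and "\<And>x y. f (x * y) = (\<Sum>(a, b)\<leftarrow>ps. a x * b y)"
proof -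
  obtain qs where "\<And>x y. f (x * y) = (\<Sum>(a, b)\<leftarrow>qs. a x * b y)"
    using f by (auto simp: finite_dual_iff)
  then obtain ps where
    ps: "set ps \<subseteq> range (\<lambda>y x. f (x * y)) \<times> fun_vs.span (range (\<lambda>x y. f (x * y)))"
      "\<And>x y. f (x * y) = (\<Sum>(a, b)\<leftarrow>ps. a x * b y)"
    using skeleton_decomposition[of "\<lambda>x y. f (x * y)" qs] by metis
  have "fun_vs.span (range (\<lambda>x y. f (x * y))) \<subseteq> finite_dual H"
    by (rule fun_vs.span_minimal[OF _ finite_dual_subspace]) (use finite_dual_translates[OF f] in auto)
  moreover have "range (\<lambda>y x. f (x * y)) \<subseteq> finite_dual H"
    using finite_dual_translates[OF f] by auto
  ultimately have "set ps \<subseteq> finite_dual H \<times> finite_dual H" using ps(1) by blast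
  then show thesis using that ps by blast
qed

lemma finite_dual_one: "dual_one H \<in> finite_dual H"
  unfolding dual_one_def
  by (rule finite_dualI[OF counit_hlinear, of "[(counit H, counit H)]"]) (simp add: counit_mult)

lemma finite_dual_antipode:
  assumes "f \<in> finite_dual H"
  shows "dual_antipode H f \<in> finite_dual H"
proof -
  obtain ps where ps: "\<And>x y. f (x * y) = (\<Sum>(a, b)\<leftarrow>ps. a x * b y)" and f: "functional f"
    using assms by (auto simp: finite_dual_iff)
  have "functional (dual_antipode H f)"
    using f by (simp add: dual_antipode_def hlinear_def hlinear_simps)
  then show ?thesis
    by (rule finite_dualI[where ps = "map (\<lambda>(a, b). (\<lambda>x. b (antipode H x), \<lambda>y. a (antipode H y))) ps"])
      (simp add: dual_antipode_def antipode_mult ps case_prod_unfold o_def mult.commute)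
qed

lemma sweedler_sum_list: "sweedler (\<lambda>a b. \<Sum>p\<leftarrow>ps. G p a b) x = (\<Sum>p\<leftarrow>ps. sweedler (G p) x)"
  by (induction ps) (simp_all add: sweedler_add, simp add: sweedler_def case_prod_unfold)

lemma finite_dual_mult:
  assumes "f \<in> finite_dual H" "g \<in> finite_dual H"
  shows "dual_mult H f g \<in> finite_dual H"
proof -
  have f: "functional f" and g: "functional g" using assms by (auto intro: finite_dual_functional)
  obtain ps where ps: "set ps \<subseteq> finite_dual H \<times> finite_dual H"
    "\<And>x y. f (x * y) = (\<Sum>(a, b)\<leftarrow>ps. a x * b y)" by (rule translate_pairs[OF assms(1)]) (rule that)
  obtain qs where qs: "set qs \<subseteq> finite_dual H \<times> finite_dual H"
    "\<And>x y. g (x * y) = (\<Sum>(a, b)\<leftarrow>qs. a x * b y)" by (rule translate_pairs[OF assms(2)]) (rule that)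
  let ?rs = "map (\<lambda>(p, q). (dual_mult H (fst p) (fst q), dual_mult H (snd p) (snd q))) (List.product ps qs)"
  have "dual_mult H f g (x * y) = (\<Sum>(a, b)\<leftarrow>?rs. a x * b y)" for x y
  proof -
    have "dual_mult H f g (x * y) = sweedler (\<lambda>a b. sweedler (\<lambda>c d. f (a * c) * g (b * d)) y) x"
      by (simp add: dual_mult_sweedler f g sweedler_mult[OF vector_space_field hbilinear_product])
    also have "\<dots> = sweedler (\<lambda>a b. sweedler (\<lambda>c d. \<Sum>(p, q)\<leftarrow>List.product ps qs.
        fst p a * snd p c * (fst q b * snd q d)) y) x"
      by (simp add: ps(2) qs(2) sum_list_product case_prod_unfold)
    also have "\<dots> = (\<Sum>(p, q)\<leftarrow>List.product ps qs.
        sweedler (\<lambda>a b. sweedler (\<lambda>c d. fst p a * snd p c * (fst q b * snd q d)) y) x)"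
      by (simp add: sweedler_sum_list case_prod_unfold)
    also have "\<dots> = (\<Sum>(p, q)\<leftarrow>List.product ps qs.
        dual_mult H (fst p) (fst q) x * dual_mult H (snd p) (snd q) y)"
    proof (rule sum_list_cong)
      fix r assume r: "r \<in> set (List.product ps qs)"
      obtain p q where pq: "r = (p, q)" by (cases r)
      have "functional (fst p)" "functional (snd p)" "functional (fst q)" "functional (snd q)"
        using r pq ps(1) qs(1) by (auto intro!: finite_dual_functional)
      then have "sweedler (\<lambda>a b. sweedler (\<lambda>c d. fst p a * snd p c * (fst q b * snd q d)) y) x
        = dual_mult H (fst p) (fst q) x * dual_mult H (snd p) (snd q) y"
        by (simp add: dual_mult_sweedler sweedler_mult_right) (simp add: sweedler_mult_left mult_ac)
      then show "(case r of (p, q) \<Rightarrow>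
          sweedler (\<lambda>a b. sweedler (\<lambda>c d. fst p a * snd p c * (fst q b * snd q d)) y) x)
        = (case r of (p, q) \<Rightarrow> dual_mult H (fst p) (fst q) x * dual_mult H (snd p) (snd q) y)"
        by (simp add: pq)
    qed
    finally show ?thesis by (simp add: case_prod_unfold o_def)
  qed
  with functional_dual_mult[OF f g] show ?thesis by (rule finite_dualI)
qed

lemma pairing_bilinear:
  "bilinear_map_on fscale fscale (*) (finite_dual H) (finite_dual H) (\<lambda>a b. a x * (b y :: 'k))"
  by unfold_locales
    (auto simp: bilinear_on_def fscale_apply algebra_simps vector_space_fscale vector_space_field
      finite_dual_subspace)

text \<open>Two tensors over the finite dual with the same values agree by \<open>function_tensor_eq_0\<close>, so
any separated expression for \<open>f (x * y)\<close> with factors in the finite dual is the coproduct.\<close>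

lemma dual_comult_eq:
  assumes ps: "set ps \<subseteq> finite_dual H \<times> finite_dual H"
    and f: "\<And>x y. f (x * y) = (\<Sum>(a, b)\<leftarrow>ps. a x * b y)"
  shows "dual_comult H f = (\<Sum>(a, b)\<leftarrow>ps. tensor fscale fscale a b)"
  unfolding dual_comult_def
proof (rule the_equality)
  show "(\<Sum>(a, b)\<leftarrow>ps. tensor fscale fscale a b) \<in> tensor_space fscale fscale (finite_dual H) (finite_dual H) \<and>
    (\<forall>x y. tensor_lift fscale fscale (finite_dual H) (finite_dual H) (\<lambda>a b. a x * b y)
      (\<Sum>(a, b)\<leftarrow>ps. tensor fscale fscale a b) = f (x * y))"
    using tensor_presentation_in_space[OF ps] bilinear_map_on.lift_presentation[OF pairing_bilinear ps] f
    by auto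
  fix t :: "('k, 'h \<Rightarrow> 'k, 'h \<Rightarrow> 'k) tensor"
  assume t: "t \<in> tensor_space fscale fscale (finite_dual H) (finite_dual H) \<and>
    (\<forall>x y. tensor_lift fscale fscale (finite_dual H) (finite_dual H) (\<lambda>a b. a x * b y) t = f (x * y))"
  then obtain qs where qs: "set qs \<subseteq> finite_dual H \<times> finite_dual H"
      "t = (\<Sum>(a, b)\<leftarrow>qs. tensor fscale fscale a b)"
    using bilinear_map_on.presentation[OF pairing_bilinear] by metis
  have "f (x * y) = (\<Sum>(a, b)\<leftarrow>qs. a x * b y)" for x y
    using t bilinear_map_on.lift_presentation[OF pairing_bilinear qs(1)] qs(2) by metis
  then have "(\<Sum>(a, b)\<leftarrow>qs @ map (\<lambda>(a, b). (- a, b)) ps. a x * b y) = 0" for x y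
    using f[of x y]
    by (simp add: case_prod_unfold o_def uminus_sum_list_map[symmetric, unfolded o_def])
  from function_tensor_eq_0[OF this]
  have "t + (\<Sum>(a, b)\<leftarrow>ps. - tensor fscale fscale a b) = 0"
    by (simp add: qs(2) case_prod_unfold o_def tensor_minus_left)
  moreover have "(\<Sum>(a, b)\<leftarrow>ps. - tensor fscale fscale a b) = - (\<Sum>(a, b)\<leftarrow>ps. tensor fscale fscale a b)"
    by (simp add: case_prod_unfold uminus_sum_list_map o_def)
  ultimately show "t = (\<Sum>(a, b)\<leftarrow>ps. tensor fscale fscale a b)" by (simp add: eq_neg_iff_add_eq_0)
qed

lemma dual_act_apply:
  assumes "f \<in> finite_dual H"
  shows "dual_act H h f = (\<lambda>g. f (g * h))"
proof -
  obtain ps where ps: "set ps \<subseteq> finite_dual H \<times> finite_dual H"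
    "\<And>x y. f (x * y) = (\<Sum>(a, b)\<leftarrow>ps. a x * b y)" by (rule translate_pairs[OF assms]) (rule that)
  have "bilinear_map_on fscale fscale fscale (finite_dual H) (finite_dual H)
    (\<lambda>a b. fscale (b h) a :: 'h \<Rightarrow> 'k)"
    by unfold_locales
      (auto simp: bilinear_on_def fscale_apply algebra_simps vector_space_fscale finite_dual_subspace)
  from bilinear_map_on.lift_presentation[OF this ps(1)]
  have "dual_act H h f = (\<Sum>(a, b)\<leftarrow>ps. fscale (b h) a)"
    by (simp add: dual_act_def dual_comult_eq[OF ps])
  then show ?thesis
    by (simp add: fun_eq_iff ps(2) sum_list_apply fscale_apply case_prod_unfold mult.commute)
qed

theorem finite_dual_hopf: "dual_hopf_subalgebra H (finite_dual H)"
proof -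
  have "dual_comult H f \<in> tensor_space fscale fscale (finite_dual H) (finite_dual H)"
    if f: "f \<in> finite_dual H" for f
  proof -
    obtain ps where ps: "set ps \<subseteq> finite_dual H \<times> finite_dual H"
      "\<And>x y. f (x * y) = (\<Sum>(a, b)\<leftarrow>ps. a x * b y)" by (rule translate_pairs[OF f]) (rule that)
    show ?thesis unfolding dual_comult_eq[OF ps] by (rule tensor_presentation_in_space[OF ps(1)])
  qed
  then show ?thesis
    by (simp add: dual_hopf_subalgebra_def finite_dual_subspace finite_dual_one finite_dual_mult
        finite_dual_antipode)
qed

text \<open>Fixing one variable in \<open>f (x * y) = \<Sum> f\<^sub>1 x * f\<^sub>2 y\<close> exhibits a translate of \<open>f\<close> as a
combination of the \<open>f\<^sub>1\<close> or of the \<open>f\<^sub>2\<close>.\<close>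

lemma hopf_subalgebra_translates:
  assumes K: "dual_hopf_subalgebra H K" and f: "f \<in> K"
  shows "(\<lambda>x. f (x * h)) \<in> K" "(\<lambda>x. f (h * x)) \<in> K"
proof -
  have sub: "K \<subseteq> finite_dual H" "fun_vs.subspace K"
    and "dual_comult H f \<in> tensor_space fscale fscale K K"
    using K f by (auto simp: dual_hopf_subalgebra_def)
  then obtain ps where ps: "set ps \<subseteq> K \<times> K" "dual_comult H f = (\<Sum>(a, b)\<leftarrow>ps. tensor fscale fscale a b)"
    using tensor_space_presentation[OF vector_space_fscale] by metis
  have fd: "f \<in> finite_dual H" using f sub by auto
  obtain qs where qs: "set qs \<subseteq> finite_dual H \<times> finite_dual H"
    "\<And>x y. f (x * y) = (\<Sum>(a, b)\<leftarrow>qs. a x * b y)" by (rule translate_pairs[OF fd]) (rule that)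
  have ps': "set ps \<subseteq> finite_dual H \<times> finite_dual H" using ps(1) sub(1) by blast
  have fps: "f (x * y) = (\<Sum>(a, b)\<leftarrow>ps. a x * b y)" for x y
    using bilinear_map_on.lift_presentation[OF pairing_bilinear ps', of x y]
      bilinear_map_on.lift_presentation[OF pairing_bilinear qs(1), of x y]
      dual_comult_eq[OF qs] qs(2)[of x y] ps(2) by simp
  have comb: "(\<Sum>p\<leftarrow>rs. fscale (c p) (g p)) \<in> K" if "\<And>p. p \<in> set rs \<Longrightarrow> g p \<in> K" for rs c and g :: "_ \<Rightarrow> 'h \<Rightarrow> 'k"
    using that
  proof (induction rs)
    case Nil
    show ?case by (simp only: list.map sum_list.Nil fun_vs.subspace_0[OF sub(2)])
  next
    case (Cons r rs)
    then have "fscale (c r) (g r) + (\<Sum>p\<leftarrow>rs. fscale (c p) (g p)) \<in> K"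
      by (intro fun_vs.subspace_add fun_vs.subspace_scale sub(2)) auto
    then show ?case by (simp only: list.map sum_list.Cons)
  qed
  have "(\<lambda>x. f (x * h)) = (\<Sum>p\<leftarrow>ps. fscale (snd p h) (fst p))"
    "(\<lambda>x. f (h * x)) = (\<Sum>p\<leftarrow>ps. fscale (fst p h) (snd p))"
    by (auto simp: fun_eq_iff fps sum_list_apply fscale_apply case_prod_unfold mult.commute)
  moreover have "(\<Sum>p\<leftarrow>ps. fscale (snd p h) (fst p)) \<in> K" "(\<Sum>p\<leftarrow>ps. fscale (fst p h) (snd p)) \<in> K"
    using ps(1) by (auto intro!: comb)
  ultimately show "(\<lambda>x. f (x * h)) \<in> K" "(\<lambda>x. f (h * x)) \<in> K" by simp_all
qed

lemma functional_antipode_right: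
  assumes "functional f"
  shows "sweedler (\<lambda>a b. f (a * antipode H b)) x = counit H x * f 1"
proof -
  have "f (sweedler (\<lambda>a b. 1 * a * antipode H b * 1) x) = counit H x * f 1"
    unfolding sweedler_antipode_right using assms by (simp add: hlinear_def)
  moreover have "f (sweedler F x) = sweedler (\<lambda>a b. f (F a b)) x" for F
    using assms by (intro additive_sweedler) (simp add: hlinear_def)
  ultimately show ?thesis by simp
qed

lemma functional_antipode_left:
  assumes "functional f"
  shows "sweedler (\<lambda>a b. f (antipode H a * b)) x = counit H x * f 1"
proof -
  have "f (sweedler (\<lambda>a b. 1 * antipode H a * b * 1) x) = counit H x * f 1"
    unfolding sweedler_antipode_left using assms by (simp add: hlinear_def)
  moreover have "f (sweedler F x) = sweedler (\<lambda>a b. f (F a b)) x" for F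
    using assms by (intro additive_sweedler) (simp add: hlinear_def)
  ultimately show ?thesis by simp
qed

end

section \<open>Translation-stable subalgebras of the dual\<close>

locale translation_stable_subalgebra = hopf_algebra H
  for H :: "('k::field, 'h::ring_1) hopf_data" +
  fixes R :: "('h \<Rightarrow> 'k) set"
  assumes finite_dual: "R \<subseteq> finite_dual H"
    and subspace: "module.subspace fscale R"
    and one: "dual_one H \<in> R"
    and mult: "f \<in> R \<Longrightarrow> g \<in> R \<Longrightarrow> dual_mult H f g \<in> R"
    and antipode: "f \<in> R \<Longrightarrow> dual_antipode H f \<in> R"
    and translate_right: "f \<in> R \<Longrightarrow> (\<lambda>x. f (x * h)) \<in> R"
    and translate_left: "f \<in> R \<Longrightarrow> (\<lambda>x. f (h * x)) \<in> R"
begin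

lemma R_functional: "f \<in> R \<Longrightarrow> functional f"
  using finite_dual finite_dual_functional by blast

lemma act_R: "f \<in> R \<Longrightarrow> dual_act H h f = (\<lambda>g. f (g * h))"
  using finite_dual by (intro dual_act_apply) auto

theorem stable_right_ideal_trivial:
  assumes I: "dual_right_ideal H R I" and stable: "\<And>h f. f \<in> I \<Longrightarrow> dual_act H h f \<in> I"
  shows "I = {0} \<or> I = R"
proof (cases "I \<subseteq> {0}")
  case True
  then show ?thesis using I by (auto simp: dual_right_ideal_def)
next
  case False
  have IR: "I \<subseteq> R" and I0: "0 \<in> I" and Idiff: "\<And>x y. x \<in> I \<Longrightarrow> y \<in> I \<Longrightarrow> x - y \<in> I"
    and Imult: "\<And>x r. x \<in> I \<Longrightarrow> r \<in> R \<Longrightarrow> dual_mult H x r \<in> I"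
    using I by (auto simp: dual_right_ideal_def)
  have Iadd: "x + y \<in> I" if "x \<in> I" "y \<in> I" for x y
    using Idiff[OF that(1) Idiff[OF I0 that(2)]] by simp
  have Isum: "(\<Sum>p\<leftarrow>ps. w p) \<in> I" if "\<And>p. p \<in> set ps \<Longrightarrow> w p \<in> I" for ps and w :: "_ \<Rightarrow> 'h \<Rightarrow> 'k"
    using that
  proof (induction ps)
    case Nil
    show ?case by (simp only: list.map sum_list.Nil I0)
  next
    case (Cons p ps)
    then have "w p + (\<Sum>p\<leftarrow>ps. w p) \<in> I" by (intro Iadd) auto
    then show ?case by (simp only: list.map sum_list.Cons)
  qed
  obtain f where "f \<in> I" "f \<noteq> 0" using False by auto
  then obtain h where f: "f \<in> I" "f h \<noteq> 0" by (auto simp: fun_eq_iff)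
  \<comment> \<open>Translation moves the point \<open>h\<close> to the unit element.\<close>
  define g where "g = dual_act H h f"
  have gI: "g \<in> I" using stable f by (simp add: g_def)
  then have gR: "g \<in> R" using IR by auto
  then have gf: "functional g" by (rule R_functional)
  have g1: "g 1 \<noteq> 0" using f IR act_R[of f h] by (auto simp: g_def)
  have "g \<in> finite_dual H" using gR finite_dual by auto
  then obtain ps where ps: "set ps \<subseteq> range (\<lambda>y x. g (x * y)) \<times> fun_vs.span (range (\<lambda>x y. g (x * y)))"
    "\<And>x y. g (x * y) = (\<Sum>(a, b)\<leftarrow>ps. a x * b y)" by (rule translate_pairs) (rule that)
  have "range (\<lambda>y x. g (x * y)) \<subseteq> I" using stable[OF gI] act_R[OF gR] by auto
  moreover have "fun_vs.span (range (\<lambda>x y. g (x * y))) \<subseteq> R"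
    by (rule fun_vs.span_minimal[OF _ subspace]) (use translate_left[OF gR] in auto)
  ultimately have "set ps \<subseteq> I \<times> R" using ps(1) by blast
  then have psIR: "fst p \<in> I" "snd p \<in> R" if p: "p \<in> set ps" for p
  proof -
    from p \<open>set ps \<subseteq> I \<times> R\<close> have "p \<in> I \<times> R" by blast
    then show "fst p \<in> I" "snd p \<in> R" by auto
  qed
  \<comment> \<open>This is \<open>\<Sum> g (x\<^sub>1 * S x\<^sub>2) = \<epsilon> x * g 1\<close>.\<close>
  have "(\<Sum>p\<leftarrow>ps. dual_mult H (fst p) (dual_antipode H (snd p))) = fscale (g 1) (dual_one H)"
  proof
    fix x
    have "(\<Sum>p\<leftarrow>ps. dual_mult H (fst p) (dual_antipode H (snd p))) x
      = (\<Sum>p\<leftarrow>ps. sweedler (\<lambda>a b. fst p a * snd p (antipode H b)) x)"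
      unfolding sum_list_apply
    proof (rule sum_list_cong)
      fix p assume "p \<in> set ps"
      then have "fst p \<in> R" "dual_antipode H (snd p) \<in> R"
        using psIR(1)[of p] IR antipode[OF psIR(2)[of p]] by blast+
      then have "functional (fst p)" "functional (dual_antipode H (snd p))"
        by (auto intro: R_functional)
      then show "dual_mult H (fst p) (dual_antipode H (snd p)) x
        = sweedler (\<lambda>a b. fst p a * snd p (antipode H b)) x"
        by (simp add: dual_mult_sweedler) (simp add: dual_antipode_def)
    qed
    also have "\<dots> = sweedler (\<lambda>a b. g (a * antipode H b)) x"
      by (simp add: sweedler_sum_list[symmetric] ps(2) case_prod_unfold)
    also have "\<dots> = fscale (g 1) (dual_one H) x"
      by (simp add: functional_antipode_right[OF gf] fscale_apply dual_one_def)
    finally show "(\<Sum>p\<leftarrow>ps. dual_mult H (fst p) (dual_antipode H (snd p))) x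
      = fscale (g 1) (dual_one H) x" .
  qed
  moreover have "(\<Sum>p\<leftarrow>ps. dual_mult H (fst p) (dual_antipode H (snd p))) \<in> I"
    by (intro Isum Imult antipode psIR)
  ultimately have g1I: "fscale (g 1) (dual_one H) \<in> I" by simp
  have "f \<in> I" if fR: "f \<in> R" for f
  proof -
    have "dual_mult H (fscale (g 1) (dual_one H)) (fscale (1 / g 1) f) \<in> I"
      using g1I fR by (intro Imult fun_vs.subspace_scale[OF subspace])
    moreover have "dual_mult H (fscale (g 1) (dual_one H)) (fscale (1 / g 1) f) = f"
      using R_functional[OF fR] R_functional[OF one] g1
      by (simp add: dual_mult_scale_left dual_mult_scale_right functional_scale dual_mult_one_left)
    ultimately show ?thesis by simp
  qed
  then show ?thesis using IR by auto
qed

end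

text \<open>The finite dual is one of the Hopf algebras that are intersected, which gives the inclusion
in the finite dual; the closure properties hold in each of them.\<close>

lemma (in hopf_algebra) corep_hopf_algebra_subalgebra:
  assumes "coefficient_coalgebra n \<pi> \<subseteq> finite_dual H"
  shows "translation_stable_subalgebra H (corep_hopf_algebra H n \<pi>)"
proof
  let ?\<K> = "{K. dual_hopf_subalgebra H K \<and> coefficient_coalgebra n \<pi> \<subseteq> K}"
  have sub: "fun_vs.subspace K" "dual_one H \<in> K"
    "\<And>f g. f \<in> K \<Longrightarrow> g \<in> K \<Longrightarrow> dual_mult H f g \<in> K" "\<And>f. f \<in> K \<Longrightarrow> dual_antipode H f \<in> K"
    "\<And>f h. f \<in> K \<Longrightarrow> (\<lambda>x. f (x * h)) \<in> K" "\<And>f h. f \<in> K \<Longrightarrow> (\<lambda>x. f (h * x)) \<in> K"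
    if "K \<in> ?\<K>" for K
    using that hopf_subalgebra_translates[of K] by (auto simp: dual_hopf_subalgebra_def)
  show "corep_hopf_algebra H n \<pi> \<subseteq> finite_dual H"
    using finite_dual_hopf assms by (auto simp: corep_hopf_algebra_def)
  show "fun_vs.subspace (corep_hopf_algebra H n \<pi>)"
    unfolding corep_hopf_algebra_def using sub(1) by (rule fun_vs.subspace_Inter[rule_format])
  show "dual_one H \<in> corep_hopf_algebra H n \<pi>"
    unfolding corep_hopf_algebra_def using sub(2) by blast
  fix f assume f: "f \<in> corep_hopf_algebra H n \<pi>"
  show "dual_mult H f g \<in> corep_hopf_algebra H n \<pi>" if "g \<in> corep_hopf_algebra H n \<pi>" for g
    using f that sub(3) unfolding corep_hopf_algebra_def by (meson InterI InterD)
  show "dual_antipode H f \<in> corep_hopf_algebra H n \<pi>"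
    using f sub(4) unfolding corep_hopf_algebra_def by (meson InterI InterD)
  show "(\<lambda>x. f (x * h)) \<in> corep_hopf_algebra H n \<pi>" for h
    using f sub(5) unfolding corep_hopf_algebra_def by (meson InterI InterD)
  show "(\<lambda>x. f (h * x)) \<in> corep_hopf_algebra H n \<pi>" for h
    using f sub(6) unfolding corep_hopf_algebra_def by (meson InterI InterD)
qed

section \<open>Matrix coefficients\<close>

locale based_H_module = left_H_module H M
  for H :: "('k::field, 'h::ring_1) hopf_data" and M :: "('k, 'h, 'v::ab_group_add) module_data" +
  fixes bs :: "'v list"
  assumes basis: "ordered_basis M bs"
begin

sublocale ms: vector_space "mscale M" by (rule vector_space_mscale)

abbreviation B :: "'v set" where "B \<equiv> set bs"

lemma independent: "ms.independent B" and span_B: "ms.span B = carrier M" and B_carrier: "B \<subseteq> carrier M"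
  and distinct: "distinct bs"
  using basis by (auto simp: ordered_basis_def)

definition coord :: "'v \<Rightarrow> 'v \<Rightarrow> 'k" where
  "coord b v = ms.representation B v b"

text \<open>For basis vectors \<open>v\<close> these are the entries of the matrix representation. Allowing
every vector \<open>v\<close> of the module makes the trivializing map definable without expanding
\<open>v\<close> in the basis.\<close>

definition coef :: "'v \<Rightarrow> 'v \<Rightarrow> 'h \<Rightarrow> 'k" where
  "coef b v h = coord b (act M h v)"

lemma coord_add: "v \<in> carrier M \<Longrightarrow> w \<in> carrier M \<Longrightarrow> coord b (v + w) = coord b v + coord b w"
  by (simp add: coord_def ms.representation_add[OF independent] span_B)

lemma coord_scale: "v \<in> carrier M \<Longrightarrow> coord b (mscale M c v) = c * coord b v"
  by (simp add: coord_def ms.representation_scale[OF independent] span_B)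

lemma coord_basis: "c \<in> B \<Longrightarrow> coord b c = (if b = c then 1 else 0)"
  by (simp add: coord_def ms.representation_basis[OF independent])

lemma coord_expand: "v \<in> carrier M \<Longrightarrow> (\<Sum>b\<in>B. mscale M (coord b v) b) = v"
  by (simp add: coord_def ms.sum_representation_eq[OF independent] span_B)

lemma act_scale:
  assumes "v \<in> carrier M"
  shows "act M h (mscale M c v) = mscale M c (act M h v)"
proof -
  have "act M h (mscale M c v) = act M h (act M (hscale H c 1) v)"
    using assms by (simp add: act_hscale act_one)
  also have "\<dots> = act M (hscale H c h) v"
    using assms by (simp add: act_mult[symmetric] hscale_mult_right[symmetric])
  finally show ?thesis using assms by (simp add: act_hscale)
qed

lemma linear_on_carrier_expand:
  fixes \<phi> :: "'v \<Rightarrow> 'u::ab_group_add"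
  assumes add: "\<And>v w. v \<in> carrier M \<Longrightarrow> w \<in> carrier M \<Longrightarrow> \<phi> (v + w) = \<phi> v + \<phi> w"
    and v: "v \<in> carrier M"
  shows "\<phi> v = (\<Sum>b\<in>B. \<phi> (mscale M (coord b v) b))"
proof -
  have "\<phi> (\<Sum>b\<in>A. mscale M (c b) b) = (\<Sum>b\<in>A. \<phi> (mscale M (c b) b))
      \<and> (\<Sum>b\<in>A. mscale M (c b) b) \<in> carrier M"
    if "finite A" "A \<subseteq> B" for A c
    using that
  proof (induction A rule: finite_induct)
    case empty
    then show ?case using add[of 0 0] ms.subspace_0[OF subspace_carrier] by simp
  next
    case (insert b A)
    then have "mscale M (c b) b \<in> carrier M"
      using B_carrier by (auto intro: ms.subspace_scale[OF subspace_carrier])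
    then show ?case using insert by (auto simp: add intro: ms.subspace_add[OF subspace_carrier])
  qed
  from this[of B "\<lambda>b. coord b v"] show ?thesis by (simp add: coord_expand v)
qed

lemma coef_expand:
  assumes "v \<in> carrier M"
  shows "coef b v = (\<Sum>b'\<in>B. fscale (coord b' v) (coef b b'))"
proof
  fix h
  have "coef b v h = (\<Sum>b'\<in>B. coef b (mscale M (coord b' v) b') h)"
    by (rule linear_on_carrier_expand[OF _ assms])
      (simp add: coef_def act_add_right coord_add act_closed)
  also have "\<dots> = (\<Sum>b'\<in>B. coord b' v * coef b b' h)"
    using B_carrier by (intro sum.cong) (auto simp: coef_def act_scale coord_scale act_closed)
  finally show "coef b v h = (\<Sum>b'\<in>B. fscale (coord b' v) (coef b b')) h"
    by (simp add: sum_apply fscale_apply)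
qed

lemma coef_functional: "v \<in> carrier M \<Longrightarrow> functional (coef b v)"
  by (simp add: hlinear_def coef_def act_add_left act_hscale coord_add coord_scale act_closed)

lemma coef_act: "v \<in> carrier M \<Longrightarrow> coef b (act M y v) x = coef b v (x * y)"
  by (simp add: coef_def act_mult)

lemma coef_mult:
  assumes "v \<in> carrier M"
  shows "coef b v (x * y) = (\<Sum>b'\<in>B. coef b b' x * coef b' v y)"
proof -
  have "coef b v (x * y) = coef b (act M y v) x" using assms by (simp add: coef_act)
  also have "\<dots> = (\<Sum>b'\<in>B. coef b b' x * coef b' v y)"
    by (simp add: coef_expand[of "act M y v"] act_closed assms sum_apply fscale_apply
        coef_def[of _ v] mult.commute)
  finally show ?thesis .
qed

lemma matrix_rep_entry:
  "i < length bs \<Longrightarrow> j < length bs \<Longrightarrow> matrix_rep M bs h $$ (i, j) = coef (bs ! i) (bs ! j) h"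
  by (simp add: matrix_rep_def coef_def coord_def)

lemma matrix_rep_carrier: "matrix_rep M bs h \<in> carrier_mat (length bs) (length bs)"
  by (simp add: matrix_rep_def)

lemma matrix_rep_dim: "dim_row (matrix_rep M bs h) = length bs" "dim_col (matrix_rep M bs h) = length bs"
  by (simp_all add: matrix_rep_def)

lemma coef_in_coefficient_coalgebra:
  assumes "b \<in> B" "c \<in> B"
  shows "coef b c \<in> coefficient_coalgebra (length bs) (matrix_rep M bs)"
proof -
  obtain i j where ij: "i < length bs" "bs ! i = b" "j < length bs" "bs ! j = c"
    using assms by (auto simp: in_set_conv_nth)
  have "coef b c = (\<lambda>A. A $$ (i, j)) \<circ> matrix_rep M bs"
    using ij by (auto simp: matrix_rep_entry)
  moreover have "matrix_functional (length bs) (\<lambda>A. A $$ (i, j))"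
    using ij by (auto simp: matrix_functional_def)
  ultimately show ?thesis by (auto simp: coefficient_coalgebra_def)
qed

text \<open>The annihilator of the module is an ideal on which all coefficients vanish. It is cofinite
because it contains the common kernel of the finitely many matrix entries.\<close>

lemma coefficient_coalgebra_finite_dual:
  "coefficient_coalgebra (length bs) (matrix_rep M bs) \<subseteq> finite_dual H"
proof
  let ?n = "length bs" and ?\<pi> = "matrix_rep M bs"
  fix f assume "f \<in> coefficient_coalgebra ?n ?\<pi>"
  then obtain \<phi> where \<phi>: "matrix_functional ?n \<phi>" "f = \<phi> \<circ> ?\<pi>"
    by (auto simp: coefficient_coalgebra_def)
  have lin_coef: "functional (coef (bs ! i) (bs ! j))" if "j < ?n" for i j
    using that B_carrier by (intro coef_functional) auto
  have "?\<pi> (x + y) = ?\<pi> x + ?\<pi> y" for x y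
    using lin_coef[unfolded hlinear_def]
    by (intro eq_matI) (simp_all add: matrix_rep_dim matrix_rep_entry)
  moreover have "?\<pi> (hscale H c x) = c \<cdot>\<^sub>m ?\<pi> x" for c x
    using lin_coef[unfolded hlinear_def]
    by (intro eq_matI) (simp_all add: matrix_rep_dim matrix_rep_entry)
  ultimately have lin: "functional f"
    using \<phi> matrix_rep_carrier by (auto simp: hlinear_def matrix_functional_def)
  define I where "I = {z. \<forall>v\<in>carrier M. act M z v = 0}"
  have act_0: "act M h 0 = 0" for h
    using act_add_right[of 0 0 h] ms.subspace_0[OF subspace_carrier] by simp
  have act_diff: "act M (x - y) v = act M x v - act M y v" if "v \<in> carrier M" for x y v
    using act_add_left[of v "x - y" y] that by (simp add: algebra_simps)
  have "act M 0 v = 0" if "v \<in> carrier M" for v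
    using act_diff[OF that, of 0 0] by simp
  then have "two_sided_ideal I"
    by (auto simp: two_sided_ideal_def I_def act_diff act_mult act_0 act_closed)
  moreover have "\<exists>C. finite C \<and> (\<forall>x. \<exists>b\<in>hs.span C. x - b \<in> I)"
  proof -
    let ?cs = "map (\<lambda>(b, c). coef b c) (List.product bs bs)"
    have "\<exists>C. finite C \<and> (\<forall>x. \<exists>b\<in>hs.span C. \<forall>c\<in>set ?cs. c (x - b) = 0)"
      by (rule common_kernel_cofinite) (use B_carrier in \<open>auto intro!: coef_functional\<close>)
    then obtain C where C: "finite C" "\<And>x. \<exists>b\<in>hs.span C. \<forall>c\<in>set ?cs. c (x - b) = 0" by blast
    have ker: "z \<in> I" if cs: "\<forall>c\<in>set ?cs. c z = 0" for z
    proof -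
      have "act M z v = 0" if v: "v \<in> carrier M" for v
      proof -
        have "coord b (act M z v) = 0" if b: "b \<in> B" for b
        proof -
          have "coef b c z = 0" if "c \<in> B" for c using cs[THEN bspec, of "coef b c"] b that by auto
          then have "(\<Sum>c\<in>B. coord c v * coef b c z) = 0" by simp
          then have "coef b v z = 0" by (simp only: coef_expand[OF v] sum_apply fscale_apply)
          then show ?thesis by (simp add: coef_def)
        qed
        then show ?thesis using coord_expand[OF act_closed[OF v, of z]] by simp
      qed
      then show ?thesis by (simp add: I_def)
    qed
    have "\<exists>b\<in>hs.span C. x - b \<in> I" for x using C(2)[of x] by (meson ker)
    then show ?thesis using C(1) by blast
  qed
  moreover have "f z = 0" if "z \<in> I" for z
  proof -
    have coef0: "coef (bs ! i) (bs ! j) z = 0" if "i < ?n" "j < ?n" for i j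
    proof -
      have "act M z (bs ! j) = 0" using nth_mem[OF that(2)] B_carrier \<open>z \<in> I\<close> unfolding I_def by blast
      then show ?thesis by (simp add: coef_def coord_def ms.representation_zero)
    qed
    have "0 \<cdot>\<^sub>m ?\<pi> z = ?\<pi> z"
      by (intro eq_matI) (simp_all add: matrix_rep_dim matrix_rep_entry coef0)
    moreover have "\<phi> (0 \<cdot>\<^sub>m ?\<pi> z) = 0 * \<phi> (?\<pi> z)"
      using \<phi>(1) matrix_rep_carrier unfolding matrix_functional_def by blast
    ultimately show ?thesis by (simp add: \<phi>(2))
  qed
  ultimately show "f \<in> finite_dual H"
    using lin by (auto simp: finite_dual_def cofinite_ideal_def hlinear_iff vector_space_field)
qed

end

section \<open>Trivialization\<close>

locale trivializing_subalgebra = based_H_module H M bs + translation_stable_subalgebra H R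
  for H :: "('k::field, 'h::ring_1) hopf_data" and M :: "('k, 'h, 'v::ab_group_add) module_data"
    and bs :: "'v list" and R :: "('h \<Rightarrow> 'k) set" +
  assumes coef_basis_R: "b \<in> B \<Longrightarrow> c \<in> B \<Longrightarrow> coef b c \<in> R"
begin

lemma R_sum: "(\<And>i. i \<in> A \<Longrightarrow> f i \<in> R) \<Longrightarrow> (\<Sum>i\<in>A. f i) \<in> R"
  by (rule fun_vs.subspace_sum[OF subspace])

lemma coef_R: "b \<in> B \<Longrightarrow> v \<in> carrier M \<Longrightarrow> coef b v \<in> R"
  by (simp add: coef_expand R_sum fun_vs.subspace_scale[OF subspace] coef_basis_R)

text \<open>The matrix with these entries is the convolution inverse of the coefficient matrix, by
\<open>inverse_coef_left\<close> and \<open>inverse_coef_right\<close>: matrix multiplication turns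
\<open>\<Sum> \<pi> (S h\<^sub>1) \<pi> (h\<^sub>2)\<close> into \<open>\<pi> (\<Sum> S h\<^sub>1 h\<^sub>2)\<close>, and the antipode axiom applies.\<close>

definition inverse_coef :: "'v \<Rightarrow> 'v \<Rightarrow> 'h \<Rightarrow> 'k" where
  "inverse_coef b c = dual_antipode H (coef b c)"

lemma inverse_coef_R: "b \<in> B \<Longrightarrow> c \<in> B \<Longrightarrow> inverse_coef b c \<in> R"
  by (simp add: inverse_coef_def coef_basis_R antipode)

lemma inverse_coef_left:
  assumes b: "b \<in> B" and v: "v \<in> carrier M"
  shows "(\<Sum>c\<in>B. dual_mult H (inverse_coef b c) (coef c v)) = fscale (coord b v) (dual_one H)"
proof
  fix x
  have "(\<Sum>c\<in>B. dual_mult H (inverse_coef b c) (coef c v)) x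
    = (\<Sum>c\<leftarrow>bs. sweedler (\<lambda>p q. coef b c (antipode H p) * coef c v q) x)"
    unfolding sum_apply
    unfolding sum.distinct_set_conv_list[OF distinct]
    using b v inverse_coef_R coef_R
    by (intro sum_list_cong)
      (simp add: dual_mult_sweedler R_functional, simp add: inverse_coef_def dual_antipode_def)
  also have "\<dots> = sweedler (\<lambda>p q. coef b v (antipode H p * q)) x"
    unfolding sweedler_sum_list[symmetric] coef_mult[OF v] sum.distinct_set_conv_list[OF distinct] ..
  also have "\<dots> = fscale (coord b v) (dual_one H) x"
    unfolding functional_antipode_left[OF coef_functional[OF v]]
    by (simp add: fscale_apply dual_one_def coef_def act_one v)
  finally show "(\<Sum>c\<in>B. dual_mult H (inverse_coef b c) (coef c v)) x
    = fscale (coord b v) (dual_one H) x" .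
qed

lemma inverse_coef_right:
  assumes b: "b \<in> B" and v: "v \<in> B"
  shows "(\<Sum>c\<in>B. dual_mult H (coef b c) (inverse_coef c v)) = fscale (coord b v) (dual_one H)"
proof
  fix x
  have v': "v \<in> carrier M" using v B_carrier by auto
  have "(\<Sum>c\<in>B. dual_mult H (coef b c) (inverse_coef c v)) x
    = (\<Sum>c\<leftarrow>bs. sweedler (\<lambda>p q. coef b c p * coef c v (antipode H q)) x)"
    unfolding sum_apply
    unfolding sum.distinct_set_conv_list[OF distinct]
    using b v inverse_coef_R coef_basis_R
    by (intro sum_list_cong)
      (simp add: dual_mult_sweedler R_functional, simp add: inverse_coef_def dual_antipode_def)
  also have "\<dots> = sweedler (\<lambda>p q. coef b v (p * antipode H q)) x"
    unfolding sweedler_sum_list[symmetric] coef_mult[OF v'] sum.distinct_set_conv_list[OF distinct] ..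
  also have "\<dots> = fscale (coord b v) (dual_one H) x"
    unfolding functional_antipode_right[OF coef_functional[OF v']]
    by (simp add: fscale_apply dual_one_def coef_def act_one v')
  finally show "(\<Sum>c\<in>B. dual_mult H (coef b c) (inverse_coef c v)) x
    = fscale (coord b v) (dual_one H) x" .
qed

text \<open>The copies of \<open>R\<close> are to be indexed by the basis, but the index set has to consist of
elements of the type of \<open>M \<otimes> R\<close>. Any injection of the vectors into that type will do; the
evaluation at \<open>(v, 0)\<close> of arbitrary functions of two variables is one.\<close>

definition tag :: "'v \<Rightarrow> ('k, 'v, 'h \<Rightarrow> 'k) tensor" where
  "tag v = (\<lambda>\<beta>. \<beta> v (\<lambda>_. 0))"

lemma tag_inj: "inj tag"
proof
  fix v w assume "tag v = tag w"
  then have "tag v (\<lambda>u _. if u = v then 1 else 0) = tag w (\<lambda>u _. if u = v then 1 else 0)" by simp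
  then show "v = w" by (simp add: tag_def split: if_splits)
qed

definition untag :: "('k, 'v, 'h \<Rightarrow> 'k) tensor \<Rightarrow> 'v" where
  "untag = the_inv tag"

lemma untag_tag [simp]: "untag (tag v) = v"
  by (simp add: untag_def the_inv_f_f tag_inj)

abbreviation J :: "('k, 'v, 'h \<Rightarrow> 'k) tensor set" where
  "J \<equiv> tag ` B"

abbreviation R_module :: "('k, 'h, 'h \<Rightarrow> 'k) module_data" where
  "R_module \<equiv> \<lparr>carrier = R, mscale = fscale, act = dual_act H\<rparr>"

abbreviation D :: "(('k, 'v, 'h \<Rightarrow> 'k) tensor \<Rightarrow> 'h \<Rightarrow> 'k) set" where
  "D \<equiv> carrier (direct_sum_copies J R_module)"

abbreviation MR :: "('k, 'v, 'h \<Rightarrow> 'k) tensor set" where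
  "MR \<equiv> tensor_space (mscale M) fscale (carrier M) R"

lemma D_iff: "F \<in> D \<longleftrightarrow> (\<forall>b\<in>B. F (tag b) \<in> R) \<and> (\<forall>j. j \<notin> J \<longrightarrow> F j = 0)"
proof -
  have "finite {j. F j \<noteq> 0}" if "\<forall>j. j \<notin> J \<longrightarrow> F j = 0"
    by (rule finite_subset[of _ J]) (use that in blast, simp)
  then show ?thesis unfolding direct_sum_copies_def by (simp only: partial_object.simps mem_Collect_eq) blast
qed

text \<open>The image of \<open>v \<otimes> f\<close> in the direct sum: the product of the coefficient matrix with the
column of coordinates of \<open>v \<otimes> f\<close>.\<close>

definition twist :: "'v \<Rightarrow> ('h \<Rightarrow> 'k) \<Rightarrow> ('k, 'v, 'h \<Rightarrow> 'k) tensor \<Rightarrow> 'h \<Rightarrow> 'k" where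
  "twist v f = (\<lambda>j. if j \<in> J then dual_mult H (coef (untag j) v) f else 0)"

definition family_scale :: "'k \<Rightarrow> ('j \<Rightarrow> 'h \<Rightarrow> 'k) \<Rightarrow> 'j \<Rightarrow> 'h \<Rightarrow> 'k" where
  "family_scale c F = (\<lambda>j. fscale c (F j))"

lemma vector_space_family_scale: "vector_space family_scale"
  by unfold_locales
    (rule ext, simp add: family_scale_def fun_vs.scale_right_distrib fun_vs.scale_left_distrib)+

sublocale \<Phi>: bilinear_map_on "mscale M" fscale family_scale "carrier M" R twist
proof (rule bilinear_map_on.intro)
  have coef_lin: "v \<in> carrier M \<Longrightarrow> w \<in> carrier M \<Longrightarrow> coef b (v + w) = coef b v + coef b w"
    "v \<in> carrier M \<Longrightarrow> coef b (mscale M c v) = fscale c (coef b v)" for b v w c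
    by (auto simp: fun_eq_iff coef_def act_add_right coord_add act_closed act_scale coord_scale
        fscale_apply)
  have "twist (v + w) f = twist v f + twist w f" "twist (mscale M c v) f = family_scale c (twist v f)"
    if "v \<in> carrier M" "w \<in> carrier M" "f \<in> R" for v w f c
    by (rule ext, simp add: twist_def family_scale_def coef_lin that R_functional coef_functional
        dual_mult_add_left dual_mult_scale_left)+
  moreover have "twist v (f + g) = twist v f + twist v g" "twist v (fscale c f) = family_scale c (twist v f)"
    if "v \<in> carrier M" "f \<in> R" "g \<in> R" for v f g c
    by (rule ext, simp add: twist_def family_scale_def that R_functional coef_functional
        dual_mult_add_right dual_mult_scale_right)+
  ultimately show "bilinear_on (mscale M) fscale family_scale (carrier M) R twist"
    unfolding bilinear_on_def by blast
qed (fact vector_space_mscale vector_space_fscale vector_space_family_scale subspace_carrier subspace)+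

abbreviation \<Phi> :: "('k, 'v, 'h \<Rightarrow> 'k) tensor \<Rightarrow> ('k, 'v, 'h \<Rightarrow> 'k) tensor \<Rightarrow> 'h \<Rightarrow> 'k" where
  "\<Phi> \<equiv> tensor_lift (mscale M) fscale (carrier M) R twist"

text \<open>Multiplication by the inverse matrix, followed by reading the result as the coordinates
of an element of \<open>M \<otimes> R\<close>.\<close>

definition \<Psi> :: "(('k, 'v, 'h \<Rightarrow> 'k) tensor \<Rightarrow> 'h \<Rightarrow> 'k) \<Rightarrow> ('k, 'v, 'h \<Rightarrow> 'k) tensor" where
  "\<Psi> F = (\<Sum>b\<in>B. tensor (mscale M) fscale b (\<Sum>c\<in>B. dual_mult H (inverse_coef b c) (F (tag c))))"

lemma twist_tag: "b \<in> B \<Longrightarrow> twist v f (tag b) = dual_mult H (coef b v) f"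
  by (simp add: twist_def)

lemma twist_D: "v \<in> carrier M \<Longrightarrow> f \<in> R \<Longrightarrow> twist v f \<in> D"
  by (auto simp: D_iff twist_tag mult coef_R) (simp add: twist_def)

lemma D_zero: "0 \<in> D"
  by (simp add: D_iff fun_vs.subspace_0[OF subspace])

lemma D_add: "F \<in> D \<Longrightarrow> G \<in> D \<Longrightarrow> F + G \<in> D"
  by (simp add: D_iff fun_vs.subspace_add[OF subspace])

lemma \<Phi>_D:
  assumes "t \<in> MR"
  shows "\<Phi> t \<in> D"
proof -
  obtain ps where ps: "set ps \<subseteq> carrier M \<times> R" "t = (\<Sum>(v, w)\<leftarrow>ps. tensor (mscale M) fscale v w)"
    using \<Phi>.presentation[OF assms] by blast
  have "(\<Sum>(v, w)\<leftarrow>ps. twist v w) \<in> D"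
    using ps(1)
  proof (induction ps)
    case Nil
    show ?case by (simp only: list.map sum_list.Nil D_zero)
  next
    case (Cons p ps)
    then have "twist (fst p) (snd p) + (\<Sum>(v, w)\<leftarrow>ps. twist v w) \<in> D"
      by (intro D_add twist_D) auto
    then show ?case by (simp only: list.map sum_list.Cons case_prod_unfold)
  qed
  then show ?thesis by (simp add: ps(2) \<Phi>.lift_presentation[OF ps(1)])
qed

lemma tensor_MR: "v \<in> carrier M \<Longrightarrow> f \<in> R \<Longrightarrow> tensor (mscale M) fscale v f \<in> MR"
  using tensor_presentation_in_space[of "[(v, f)]" "carrier M" R "mscale M" fscale] by simp

lemma MR_sum: "(\<And>i. i \<in> A \<Longrightarrow> g i \<in> MR) \<Longrightarrow> (\<Sum>i\<in>A. g i) \<in> MR"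
  unfolding tensor_space_def by (rule fun_vs.span_sum)

lemma \<Psi>_MR:
  assumes "F \<in> D"
  shows "\<Psi> F \<in> MR"
  unfolding \<Psi>_def
  using assms B_carrier by (intro MR_sum tensor_MR R_sum mult inverse_coef_R) (auto simp: D_iff)

lemma \<Psi>_add:
  assumes "F \<in> D" "G \<in> D"
  shows "\<Psi> (F + G) = \<Psi> F + \<Psi> G"
  unfolding \<Psi>_def
  using assms
  by (simp add: dual_mult_add_right R_functional inverse_coef_R D_iff tensor_add_right sum.distrib)

lemma \<Psi>_twist:
  assumes v: "v \<in> carrier M" and f: "f \<in> R"
  shows "\<Psi> (twist v f) = tensor (mscale M) fscale v f"
proof -
  have "(\<Sum>c\<in>B. dual_mult H (inverse_coef b c) (twist v f (tag c))) = fscale (coord b v) f"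
    if b: "b \<in> B" for b
  proof -
    have "(\<Sum>c\<in>B. dual_mult H (inverse_coef b c) (twist v f (tag c)))
      = (\<Sum>c\<in>B. dual_mult H (dual_mult H (inverse_coef b c) (coef c v)) f)"
      using v f b
      by (intro sum.cong refl)
        (simp add: twist_tag dual_mult_assoc R_functional inverse_coef_R coef_functional)
    also have "\<dots> = dual_mult H (\<Sum>c\<in>B. dual_mult H (inverse_coef b c) (coef c v)) f"
      using v f b
      by (intro dual_mult_sum_left[symmetric])
        (simp_all add: R_functional mult inverse_coef_R coef_R)
    also have "\<dots> = fscale (coord b v) f"
      using R_functional[OF f] R_functional[OF one]
      by (simp add: inverse_coef_left[OF b v] dual_mult_scale_left dual_mult_one_left)
    finally show ?thesis .
  qed
  then have "\<Psi> (twist v f) = (\<Sum>b\<in>B. tensor (mscale M) fscale b (fscale (coord b v) f))"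
    by (simp add: \<Psi>_def)
  also have "\<dots> = tensor (mscale M) fscale (\<Sum>b\<in>B. mscale M (coord b v) b) f"
    by (simp only: tensor_sum_left tensor_scale tensor_scale_right)
  finally show ?thesis by (simp add: coord_expand v)
qed

text \<open>Both the composition and the identity are induced by the bilinear map \<open>(v, f) \<mapsto> v \<otimes> f\<close>.\<close>

lemma \<Psi>_\<Phi>:
  assumes "t \<in> MR"
  shows "\<Psi> (\<Phi> t) = t"
proof -
  let ?t = "tensor (mscale M) (fscale :: 'k \<Rightarrow> ('h \<Rightarrow> 'k) \<Rightarrow> _)"
  have bil: "bilinear_on (mscale M) fscale fscale (carrier M) R ?t"
    by (simp add: bilinear_on_def tensor_add_left tensor_add_right tensor_scale tensor_scale_right)
  note unique = tensor_lift_unique[OF vector_space_mscale vector_space_fscale vector_space_fscale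
      subspace_carrier subspace bil _ _ assms]
  have "\<Psi> (\<Phi> t) = tensor_lift (mscale M) fscale (carrier M) R ?t t"
    by (rule unique[where g = "\<lambda>t. \<Psi> (\<Phi> t)"])
      (simp_all add: \<Phi>.lift_add \<Psi>_add \<Phi>_D \<Phi>.lift_tensor \<Psi>_twist)
  moreover have "t = tensor_lift (mscale M) fscale (carrier M) R ?t t"
    by (rule unique[where g = "\<lambda>t. t"]) simp_all
  ultimately show ?thesis by simp
qed

lemma \<Phi>_\<Psi>:
  assumes F: "F \<in> D"
  shows "\<Phi> (\<Psi> F) = F"
proof -
  let ?r = "\<lambda>b. \<Sum>c\<in>B. dual_mult H (inverse_coef b c) (F (tag c))"
  have FR: "F (tag c) \<in> R" if "c \<in> B" for c using F that by (simp add: D_iff)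
  have r: "?r b \<in> R" if "b \<in> B" for b using that FR by (intro R_sum mult inverse_coef_R)
  have "\<Phi> (\<Psi> F) = (\<Sum>b\<leftarrow>bs. \<Phi> (tensor (mscale M) fscale b (?r b)))"
    unfolding \<Psi>_def sum.distinct_set_conv_list[OF distinct, of "\<lambda>b. tensor (mscale M) fscale b (?r b)"]
    using r B_carrier by (intro \<Phi>.lift_sum_list[THEN conjunct1] tensor_MR) auto
  also have "\<dots> = (\<Sum>b\<in>B. twist b (?r b))"
    unfolding sum.distinct_set_conv_list[OF distinct, of "\<lambda>b. twist b (?r b)"]
    using r B_carrier by (intro sum_list_cong \<Phi>.lift_tensor) auto
  finally have \<Phi>\<Psi>: "\<Phi> (\<Psi> F) = (\<Sum>b\<in>B. twist b (?r b))" .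
  have "\<Phi> (\<Psi> F) j = F j" for j
  proof (cases "j \<in> J")
    case False
    then show ?thesis using F by (simp add: \<Phi>\<Psi> sum_apply twist_def D_iff)
  next
    case True
    then obtain l where l: "l \<in> B" "j = tag l" by auto
    have "\<Phi> (\<Psi> F) j = (\<Sum>b\<in>B. dual_mult H (coef l b) (?r b))"
      by (simp add: \<Phi>\<Psi> sum_apply l twist_tag)
    also have "\<dots> = (\<Sum>b\<in>B. \<Sum>c\<in>B. dual_mult H (dual_mult H (coef l b) (inverse_coef b c)) (F (tag c)))"
      using l(1) FR
      by (intro sum.cong refl)
        (simp add: dual_mult_sum_right dual_mult_assoc R_functional coef_basis_R inverse_coef_R mult)
    also have "\<dots> = (\<Sum>c\<in>B. dual_mult H (\<Sum>b\<in>B. dual_mult H (coef l b) (inverse_coef b c)) (F (tag c)))"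
      using l(1) FR
      by (subst sum.swap, intro sum.cong refl)
        (simp add: dual_mult_sum_left R_functional coef_basis_R inverse_coef_R mult)
    also have "\<dots> = (\<Sum>c\<in>B. fscale (coord l c) (F (tag c)))"
      using l(1) FR R_functional[OF one]
      by (intro sum.cong refl)
        (simp add: inverse_coef_right dual_mult_scale_left dual_mult_one_left R_functional)
    also have "\<dots> = (\<Sum>c\<in>B. if c = l then F (tag c) else 0)"
      by (intro sum.cong refl) (auto simp: coord_basis fun_eq_iff fscale_apply)
    also have "\<dots> = F j" using l by simp
    finally show ?thesis .
  qed
  then show ?thesis by (rule ext)
qed

text \<open>Both sides are \<open>\<Sum> c (g\<^sub>1 h\<^sub>1) f (g\<^sub>2 h\<^sub>2)\<close> for the coefficient \<open>c\<close> of \<open>v\<close> at \<open>l\<close>: the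
diagonal action is the coproduct of \<open>h\<close>, the product in \<open>R\<close> is the coproduct of \<open>g\<close>, and
the coproduct is multiplicative.\<close>

lemma twist_equivariant:
  assumes v: "v \<in> carrier M" and f: "f \<in> R" and l: "l \<in> B"
  shows "sweedler (\<lambda>a b. twist (act M a v) (\<lambda>g. f (g * b)) (tag l) g) h
    = dual_mult H (coef l v) f (g * h)"
proof -
  have "sweedler (\<lambda>a b. twist (act M a v) (\<lambda>g. f (g * b)) (tag l) g) h
    = sweedler (\<lambda>a b. sweedler (\<lambda>p q. coef l v (p * a) * f (q * b)) g) h"
    using v f l
    by (simp add: twist_tag dual_mult_sweedler coef_functional act_closed coef_act
        R_functional[OF translate_right])
  also have "\<dots> = sweedler (\<lambda>p q. sweedler (\<lambda>a b. coef l v (p * a) * f (q * b)) h) g"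
    by (rule sweedler_swap)
  also have "\<dots> = dual_mult H (coef l v) f (g * h)"
    using v f
    by (simp add: dual_mult_sweedler coef_functional R_functional
        sweedler_mult[OF vector_space_field hbilinear_product])
  finally show ?thesis .
qed

lemma tensor_act:
  assumes ps: "set ps \<subseteq> carrier M \<times> R"
  shows "act (tensor_module H M R_module) h (\<Sum>(v, w)\<leftarrow>ps. tensor (mscale M) fscale v w)
    = (\<Sum>(v, w)\<leftarrow>ps. sweedler (\<lambda>a b. tensor (mscale M) fscale (act M a v) (\<lambda>g. w (g * b))) h)"
proof -
  let ?t = "tensor (mscale M) (fscale :: 'k \<Rightarrow> ('h \<Rightarrow> 'k) \<Rightarrow> _)"
  let ?F = "\<lambda>a b. \<Sum>(v, w)\<leftarrow>ps. ?t (act M a v) (\<lambda>g. w (g * b))"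
  have map_eq: "tensor_map (mscale M) fscale (mscale M) fscale (carrier M) R (act M a) (dual_act H b)
      (\<Sum>(v, w)\<leftarrow>ps. ?t v w) = ?F a b" for a b
  proof -
    have act_fun: "dual_act H b (w + w') = dual_act H b w + dual_act H b w'"
      "dual_act H b (fscale c w) = fscale c (dual_act H b w)" if "w \<in> R" "w' \<in> R" for w w' c
      using that
      by (auto simp: fun_eq_iff act_R fun_vs.subspace_add[OF subspace]
          fun_vs.subspace_scale[OF subspace] fscale_apply)
    have "bilinear_on (mscale M) fscale fscale (carrier M) R (\<lambda>v w. ?t (act M a v) (dual_act H b w))"
      unfolding bilinear_on_def
      by (auto simp: act_add_right act_scale act_fun tensor_add_left tensor_add_right tensor_scale
          tensor_scale_right)
    from tensor_lift_presentation[OF vector_space_mscale vector_space_fscale vector_space_fscale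
        subspace_carrier subspace this ps]
    have "tensor_map (mscale M) fscale (mscale M) fscale (carrier M) R (act M a) (dual_act H b)
        (\<Sum>(v, w)\<leftarrow>ps. ?t v w) = (\<Sum>(v, w)\<leftarrow>ps. ?t (act M a v) (dual_act H b w))"
      by (simp add: tensor_map_def)
    also have "\<dots> = ?F a b"
      using ps by (intro sum_list_cong) (auto simp: act_R)
    finally show ?thesis .
  qed
  have summand: "hbilinear fscale (\<lambda>a b. ?t (act M a v) (\<lambda>g. w (g * b)))"
    if "v \<in> carrier M" "w \<in> R" for v w
  proof -
    have lin: "functional w" using that by (auto intro: R_functional)
    have "(\<lambda>g. w (g * (b + b'))) = (\<lambda>g. w (g * b)) + (\<lambda>g. w (g * b'))"
      "(\<lambda>g. w (g * hscale H c b)) = fscale c (\<lambda>g. w (g * b))" for b b' c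
      using lin
      by (auto simp: fun_eq_iff hlinear_def distrib_left hscale_mult_right[symmetric] fscale_apply)
    then show ?thesis
      using that
      by (simp add: hbilinear_def hlinear_def act_add_left act_hscale tensor_add_left
          tensor_add_right tensor_scale tensor_scale_right)
  qed
  have "hbilinear fscale (\<lambda>a b. case p of (v, w) \<Rightarrow> ?t (act M a v) (\<lambda>g. w (g * b)))"
    if "p \<in> set ps" for p
    using ps that summand[of "fst p" "snd p"] unfolding case_prod_unfold by auto
  then have "hbilinear fscale ?F" by (rule hbilinear_sum_list[OF vector_space_fscale])
  then have "act (tensor_module H M R_module) h (\<Sum>(v, w)\<leftarrow>ps. ?t v w) = sweedler ?F h"
    by (simp add: tensor_module_def map_eq hlift_comult[OF vector_space_fscale])
  then show ?thesis by (simp add: sweedler_sum_list case_prod_unfold)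
qed

lemma \<Phi>_equivariant:
  assumes t: "t \<in> MR"
  shows "\<Phi> (act (tensor_module H M R_module) h t) = act (direct_sum_copies J R_module) h (\<Phi> t)"
proof
  fix j
  obtain ps where ps: "set ps \<subseteq> carrier M \<times> R" "t = (\<Sum>(v, w)\<leftarrow>ps. tensor (mscale M) fscale v w)"
    using \<Phi>.presentation[OF t] by blast
  let ?G = "\<lambda>p a b. tensor (mscale M) (fscale :: 'k \<Rightarrow> ('h \<Rightarrow> 'k) \<Rightarrow> _) (act M a (fst p)) (\<lambda>g. snd p (g * b))"
  let ?G' = "\<lambda>p a b. twist (act M a (fst p)) (\<lambda>g. snd p (g * b))"
  have inner: "\<Phi> (sweedler (?G p) h) = sweedler (?G' p) h \<and> sweedler (?G p) h \<in> MR"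
    if p: "p \<in> set ps" for p
  proof -
    have "p \<in> carrier M \<times> R" using p ps(1) by blast
    then have mem: "act M a (fst p) \<in> carrier M" "(\<lambda>g. snd p (g * b)) \<in> R" for a b
      by (auto intro: act_closed translate_right)
    show ?thesis
      using \<Phi>.lift_sum_list[of "coproduct_pairs h" "\<lambda>(a, b). ?G p a b"] tensor_MR[OF mem] \<Phi>.lift_tensor[OF mem]
      by (simp add: sweedler_def case_prod_unfold)
  qed
  have "\<Phi> (act (tensor_module H M R_module) h t) = \<Phi> (\<Sum>p\<leftarrow>ps. sweedler (?G p) h)"
    using tensor_act[OF ps(1), of h] by (simp only: ps(2) case_prod_unfold)
  also have "\<dots> = (\<Sum>p\<leftarrow>ps. \<Phi> (sweedler (?G p) h))"
    using inner by (intro \<Phi>.lift_sum_list[THEN conjunct1]) auto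
  also have "\<dots> = (\<Sum>p\<leftarrow>ps. sweedler (?G' p) h)"
    using inner by (intro sum_list_cong) auto
  finally have lhs: "\<Phi> (act (tensor_module H M R_module) h t) = (\<Sum>p\<leftarrow>ps. sweedler (?G' p) h)" .
  have apply_list: "(\<Sum>x\<leftarrow>xs. g x) y = (\<Sum>x\<leftarrow>xs. g x y)"
    for xs :: "'x list" and g :: "'x \<Rightarrow> ('k, 'v, 'h \<Rightarrow> 'k) tensor \<Rightarrow> 'h \<Rightarrow> 'k" and y
    by (induction xs) auto
  have \<Phi>t: "\<Phi> t = (\<Sum>p\<leftarrow>ps. twist (fst p) (snd p))"
    using \<Phi>.lift_presentation[OF ps(1)] by (simp only: ps(2) case_prod_unfold)
  show "\<Phi> (act (tensor_module H M R_module) h t) j = act (direct_sum_copies J R_module) h (\<Phi> t) j"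
  proof (cases "j \<in> J")
    case False
    then show ?thesis
      by (simp add: lhs apply_list sweedler_def case_prod_unfold direct_sum_copies_def twist_def)
  next
    case True
    then obtain l where l: "l \<in> B" "j = tag l" by auto
    show ?thesis
    proof
      fix g
      have "\<Phi> (act (tensor_module H M R_module) h t) j g
        = (\<Sum>p\<leftarrow>ps. sweedler (\<lambda>a b. ?G' p a b (tag l) g) h)"
        by (simp add: lhs apply_list sum_list_apply sweedler_def case_prod_unfold l(2))
      also have "\<dots> = (\<Sum>p\<leftarrow>ps. dual_mult H (coef l (fst p)) (snd p) (g * h))"
        using ps(1) l(1) by (intro sum_list_cong twist_equivariant) auto
      also have "\<dots> = \<Phi> t (tag l) (g * h)"
        by (simp add: \<Phi>t apply_list sum_list_apply twist_tag l(1))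
      also have "\<dots> = act (direct_sum_copies J R_module) h (\<Phi> t) j g"
        using \<Phi>_D[OF t] l by (simp add: direct_sum_copies_def D_iff act_R)
      finally show "\<Phi> (act (tensor_module H M R_module) h t) j g
        = act (direct_sum_copies J R_module) h (\<Phi> t) j g" .
    qed
  qed
qed

theorem trivialized: "trivialized_by H M R_module"
  unfolding trivialized_by_def module_isomorphic_def
proof (intro exI[of _ J] exI[of _ \<Phi>] conjI allI ballI)
  have carrier: "carrier (tensor_module H M R_module) = MR" by (simp add: tensor_module_def)
  show "bij_betw \<Phi> (carrier (tensor_module H M R_module)) D"
    unfolding carrier
    by (rule bij_betw_byWitness[of _ \<Psi>]) (auto simp: \<Psi>_\<Phi> \<Phi>_\<Psi> \<Phi>_D \<Psi>_MR)
  fix s assume s: "s \<in> carrier (tensor_module H M R_module)"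
  show "\<Phi> (s + t) = \<Phi> s + \<Phi> t" if "t \<in> carrier (tensor_module H M R_module)" for t
    using s that unfolding carrier by (rule \<Phi>.lift_add)
  show "\<Phi> (mscale (tensor_module H M R_module) c s) = mscale (direct_sum_copies J R_module) c (\<Phi> s)" for c
    using \<Phi>.lift_scale[of s c] s
    by (simp add: tensor_module_def direct_sum_copies_def family_scale_def)
  show "\<Phi> (act (tensor_module H M R_module) h s) = act (direct_sum_copies J R_module) h (\<Phi> s)" for h
    using s unfolding carrier by (rule \<Phi>_equivariant)
qed

end

theorem proposition14p1:
  fixes H :: "('k::field, 'h::ring_1) hopf_data"
    and M :: "('k, 'h, 'v::ab_group_add) module_data"
    and bs :: "'v list"
    and n :: nat
    and \<pi> :: "'h \<Rightarrow> 'k mat"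
    and R :: "('k, 'h, 'h \<Rightarrow> 'k) module_data"
  assumes "hopf_algebra H"
    and "left_H_module H M"
    and "ordered_basis M bs"
    and "n = length bs"
    and "\<pi> = matrix_rep M bs"
    and "R = corep_module H n \<pi>"
  shows "trivialized_by H M R
    \<and> (\<forall>I. dual_ideal H (carrier R) I \<and> act_stable R I \<longrightarrow> I = {0} \<or> I = carrier R)
    \<and> (\<forall>I. dual_right_ideal H (carrier R) I \<and> act_stable R I \<longrightarrow> I = {0} \<or> I = carrier R)"
proof -
  interpret left_H_module H M by fact
  interpret based_H_module H M bs by unfold_locales fact
  let ?R = "corep_hopf_algebra H n \<pi>"
  have R: "R = \<lparr>carrier = ?R, mscale = fscale, act = dual_act H\<rparr>"
    using assms(6) by (simp add: corep_module_def)
  interpret translation_stable_subalgebra H ?R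
    using corep_hopf_algebra_subalgebra coefficient_coalgebra_finite_dual assms(4,5) by simp
  interpret trivializing_subalgebra H M bs ?R
  proof
    fix b c assume "b \<in> B" "c \<in> B"
    then have "coef b c \<in> coefficient_coalgebra n \<pi>"
      unfolding assms(4,5) by (rule coef_in_coefficient_coalgebra)
    then show "coef b c \<in> ?R" by (auto simp: corep_hopf_algebra_def)
  qed
  have right: "\<forall>I. dual_right_ideal H (carrier R) I \<and> act_stable R I \<longrightarrow> I = {0} \<or> I = carrier R"
    using stable_right_ideal_trivial by (auto simp: R act_stable_def)
  moreover have "trivialized_by H M R" unfolding R by (rule trivialized)
  ultimately show ?thesis unfolding dual_ideal_def by blast
qed

end
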